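(* Assume that Conjecture F, Conjecture I and Conjecture Z (stated in the context) hold. Let $f_1,f_2$ be non-zero $E$-functions. Then $f_1/\gcd(f_1,f_2)$ and $f_2/\gcd(f_1,f_2)$ have no common zero in $\mathbb C$; equivalently, the common zeros of $f_1$ and $f_2$ in $\mathbb C$ are exactly the zeros of $\gcd(f_1,f_2)$, and at any such zero $\xi$ the order of vanishing of $\gcd(f_1,f_2)$ is the minimum of the orders of vanishing of $f_1$ and $f_2$ at $\xi$. Moreover, without assuming any conjecture, the same conclusion holds whenever $f_1$ and $f_2$ are simple $E$-functions (with $\gcd$ of simple functions as defined in the context).
   Context: $\overline{\mathbb Q}$ is embedded in $\mathbb C$. A power series $f(x)=\sum_{n\ge0}a_n x^n/n!\in\overline{\mathbb Q}[[x]]$ is an $E$-function if: (i) $f$ satisfies a non-zero linear differential equation with coefficients in $\overline{\mathbb Q}(x)$; (ii) there is $C_1>0$ such that all Galois conjugates of $a_n$ have modulus $\le C_1^{n+1}$ for all $n\ge0$; (iii) there are $C_2>0$ and positive integers $d_n\le C_2^{n+1}$ such that $d_na_m$ is an algebraic integer for all $m\le n$. $E$-functions form a ring $\mathcal E$ whose units are the functions $\lambda e^{\alpha x}$, $\lambda,\alpha\in\overline{\mathbb Q}$, $\lambda\ne0$. An irreducible $E$-function is a non-unit $f$ such that $f=gh$ with $g,h\in\mathcal E$ implies $g$ or $h$ is a unit. A simple $E$-function is one of the form $g(x)=x^{-\omega}e^{\alpha x}\sum_{i=1}^N\lambda_ie^{\beta r_ix}$ with $\alpha,\beta\in\overline{\mathbb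 Q}$, $\beta\ne0$, $N\ge2$, $\lambda_i\in\overline{\mathbb Q}^*$, pairwise distinct $r_i\in\mathbb Q$, and the integer $\omega$ chosen so that $g$ is holomorphic at $0$ with $g(0)\ne0$; its support is $\mathrm{Span}_{\mathbb Q}(\beta)$. Every simple $g$ with support $V$ can be written $g(x)=x^{-\mathrm{ord}_1P}u(x)P(e^{\beta x})$ with $\beta\in V\setminus\{0\}$, $u$ a unit, $P\in\overline{\mathbb Q}[X]$, $P(0)\ne0$ ($\mathrm{ord}_1P$ = multiplicity of $1$ as a root of $P$), and two simple functions with the same support can be so written with a common $\beta$; for such $g_1,g_2$, $\gcd(g_1,g_2)(x):=P(e^{\beta x})$ with $P=\gcd(P_1,P_2)$ in $\overline{\mathbb Q}[X]$. For simple $g_1,g_2$ with different supports, $\gcd(g_1,g_2):=1$; also $\gcd(g,1)=\gcd(1,g)=\gcd(1,1)=1$. A non-zero $f\in\mathcal E$ with Taylor expansion $\sum_n a_nx^n$ at $0$ is normalized if for some $p\ge0$, $a_0=\dots=a_{p-1}=0$, $a_p=1$, $a_{p+1}=0$. Conjecture F: every non-zero $E$-function $f$ can be written as $f=us_1\cdots s_ph_1\cdots h_n$ ($p,n\ge0$) with $u$ a unit, $s_1,\dots,s_p$ simple normalized $E$-functions with pairwise distinct supports, and $h_1,\dots,h_n$ irreducible normalized $E$-functions, and these are unique (the $s_i$, $h_j$ up to order). Under Conjecture F, $s_V(f)$ is the $s_i$ with support $V$ if any, else $1$; $v_h(f)$ is the number of $j$ with $h_j=h$; and $\gcd(f_1,f_2):=\prod_V\gcd(s_V(f_1),s_V(f_2))\prod_h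 h^{\min(v_h(f_1),v_h(f_2))}$, products over one-dimensional $\mathbb Q$-subspaces $V\subset\overline{\mathbb Q}$ and normalized irreducible $h$ (all but finitely many factors equal $1$). Conjecture I: if two irreducible $E$-functions $h_1,h_2$ have a common zero in $\mathbb C$, then $h_1=uh_2$ for some unit $u$. Conjecture Z: if $\xi\in\mathbb C^*$ and $e^{\beta\xi}\in\overline{\mathbb Q}$ for some $\beta\in\overline{\mathbb Q}^*$, then $h(\xi)\neq0$ for every irreducible $E$-function $h$.
   Formalization: For simple functions with the same support, the gcd is taken as x^{-ord_1 P} P(e^{βx}) instead of P(e^{βx}); otherwise the claim fails at 0, e.g. for g1 = g2 = (e^x−1)/x, where e^x−1 vanishes at 0 but g1(0) = 1. *)

theory Defs
  imports
    "HOL-Complex_Analysis.Complex_Analysis"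
    "HOL-Computational_Algebra.Computational_Algebra"
    "HOL-Computational_Algebra.Field_as_Ring"
begin

text \<open>
  Throughout, the field of algebraic numbers is the set of complex numbers satisfying
  \<^const>\<open>algebraic\<close>, and an \<open>E\<close>-function is represented by its Taylor series at \<open>0\<close>, a
  \<^typ>\<open>complex fps\<close>; its value at a complex number is given by \<^const>\<open>eval_fps\<close>.
\<close>

section \<open>E-functions\<close>

definition galois_conjugate :: "complex \<Rightarrow> complex \<Rightarrow> bool" where
  "galois_conjugate a b \<longleftrightarrow>
     (\<exists>p :: rat poly. irreducible p \<and> poly (map_poly of_rat p) a = 0 \<and> poly (map_poly of_rat p) b = 0)"

definition algebraic_poly :: "complex poly \<Rightarrow> bool" where
  "algebraic_poly p \<longleftrightarrow> (\<forall>i. algebraic (coeff p i))"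

text \<open>Rational functions with algebraic coefficients, viewed as formal Laurent series.\<close>

definition algebraic_ratfun :: "complex fls \<Rightarrow> bool" where
  "algebraic_ratfun R \<longleftrightarrow>
     (\<exists>p q. algebraic_poly p \<and> algebraic_poly q \<and> q \<noteq> 0 \<and>
        R = fps_to_fls (fps_of_poly p) / fps_to_fls (fps_of_poly q))"

definition holonomic :: "complex fps \<Rightarrow> bool" where
  "holonomic f \<longleftrightarrow>
     (\<exists>(k::nat) R. (\<forall>i\<le>k. algebraic_ratfun (R i)) \<and> (\<exists>i\<le>k. R i \<noteq> 0) \<and>
        (\<Sum>i\<le>k. R i * fps_to_fls ((fps_deriv ^^ i) f)) = 0)"

text \<open>The series is \<open>f = (\<Sum>n. a n * x ^ n / n!)\<close>, so \<open>a n\<close> is \<open>n!\<close> times the \<open>n\<close>-th Taylor coefficient.\<close>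

definition E_function :: "complex fps \<Rightarrow> bool" where
  "E_function f \<longleftrightarrow>
     (let a = (\<lambda>n. fact n * fps_nth f n) in
        (\<forall>n. algebraic (a n)) \<and>
        holonomic f \<and>
        (\<exists>C1::real. C1 > 0 \<and> (\<forall>n b. galois_conjugate (a n) b \<longrightarrow> norm b \<le> C1 ^ (n + 1))) \<and>
        (\<exists>(C2::real) (d::nat \<Rightarrow> nat). C2 > 0 \<and>
           (\<forall>n. d n > 0 \<and> real (d n) \<le> C2 ^ (n + 1) \<and>
              (\<forall>m\<le>n. algebraic_int (of_nat (d n) * a m)))))"

definition E_unit :: "complex fps \<Rightarrow> bool" where
  "E_unit u \<longleftrightarrow> E_function u \<and> (\<exists>v. E_function v \<and> u * v = 1)"

definition E_irreducible :: "complex fps \<Rightarrow> bool" where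
  "E_irreducible f \<longleftrightarrow>
     E_function f \<and> \<not> E_unit f \<and>
     (\<forall>g h. E_function g \<and> E_function h \<and> f = g * h \<longrightarrow> E_unit g \<or> E_unit h)"

definition normalized :: "complex fps \<Rightarrow> bool" where
  "normalized f \<longleftrightarrow>
     (\<exists>p. (\<forall>i<p. fps_nth f i = 0) \<and> fps_nth f p = 1 \<and> fps_nth f (p + 1) = 0)"


section \<open>Simple E-functions\<close>

definition rat_span :: "complex \<Rightarrow> complex set" where
  "rat_span \<beta> = range (\<lambda>q::rat. of_rat q * \<beta>)"

definition rational_line :: "complex set \<Rightarrow> bool" where
  "rational_line V \<longleftrightarrow> (\<exists>\<beta>. algebraic \<beta> \<and> \<beta> \<noteq> 0 \<and> V = rat_span \<beta>)"

text \<open>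
  The equation \<open>g = x powi (-\<omega>) * ...\<close> is multiplied out. Since the exponential sum is holomorphic at \<open>0\<close>
  and \<open>g\<close> does not vanish there, \<open>\<omega>\<close> is a natural number. Such a \<open>g\<close> is automatically an
  \<open>E\<close>-function, and \<open>g\<close> determines \<open>V\<close> because the functions \<open>x ^ k * exp (\<gamma> * x)\<close> are
  linearly independent.
\<close>

definition simple_with_support :: "complex set \<Rightarrow> complex fps \<Rightarrow> bool" where
  "simple_with_support V g \<longleftrightarrow>
     (\<exists>(\<omega>::nat) \<alpha> \<beta> (N::nat) (c :: nat \<Rightarrow> complex) (r :: nat \<Rightarrow> rat).
        algebraic \<alpha> \<and> algebraic \<beta> \<and> \<beta> \<noteq> 0 \<and> N \<ge> 2 \<and>
        (\<forall>i<N. algebraic (c i) \<and> c i \<noteq> 0) \<and> inj_on r {..<N} \<and>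
        fps_X ^ \<omega> * g = fps_exp \<alpha> * (\<Sum>i<N. fps_const (c i) * fps_exp (\<beta> * of_rat (r i))) \<and>
        fps_nth g 0 \<noteq> 0 \<and> V = rat_span \<beta>)"

definition E_simple :: "complex fps \<Rightarrow> bool" where
  "E_simple g \<longleftrightarrow> (\<exists>V. simple_with_support V g)"

text \<open>
  The series of \<open>x powi (- order 1 P) * P (exp (\<beta> * x))\<close>. For \<open>\<beta> \<noteq> 0\<close> and \<open>P \<noteq> 0\<close> the function
  \<open>P (exp (\<beta> * x))\<close> vanishes at \<open>0\<close> to order exactly \<open>order 1 P\<close>, so the shift loses no coefficient.
\<close>

definition exp_poly :: "complex \<Rightarrow> complex poly \<Rightarrow> complex fps" where
  "exp_poly \<beta> P = fps_shift (order 1 P) (poly (map_poly fps_const P) (fps_exp \<beta>))"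

definition simple_rep :: "complex \<Rightarrow> complex poly \<Rightarrow> complex fps \<Rightarrow> bool" where
  "simple_rep \<beta> P g \<longleftrightarrow>
     algebraic_poly P \<and> poly P 0 \<noteq> 0 \<and> (\<exists>u. E_unit u \<and> g = u * exp_poly \<beta> P)"

text \<open>
  The gcd of polynomials with algebraic coefficients does not change when it is computed over the
  complex numbers. The exponential \<open>\<beta>\<close> and the polynomials are not unique; another choice changes
  the result by a unit. The factor \<open>x powi (- order 1 P)\<close> in \<^const>\<open>exp_poly\<close> is needed at \<open>0\<close>: simple functions
  do not vanish there, whereas \<open>P (exp (\<beta> * x))\<close> does as soon as \<open>P 1 = 0\<close>.
\<close>

definition simple_gcd :: "complex fps \<Rightarrow> complex fps \<Rightarrow> complex fps" where
  "simple_gcd g1 g2 =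
     (if \<exists>V. simple_with_support V g1 \<and> simple_with_support V g2
      then SOME d. \<exists>V \<beta> P1 P2.
             simple_with_support V g1 \<and> simple_with_support V g2 \<and> \<beta> \<in> V - {0} \<and>
             simple_rep \<beta> P1 g1 \<and> simple_rep \<beta> P2 g2 \<and> d = exp_poly \<beta> (gcd P1 P2)
      else 1)"


section \<open>Factorizations and the conjectures\<close>

text \<open>
  The simple factors have pairwise distinct supports, hence are pairwise distinct and form a set;
  the irreducible factors may be repeated and form a multiset.
\<close>

definition E_factorization ::
    "complex fps \<Rightarrow> complex fps \<times> complex fps set \<times> complex fps multiset \<Rightarrow> bool" where
  "E_factorization f = (\<lambda>(u, S, H).
     E_unit u \<and>
     finite S \<and> (\<forall>s\<in>S. E_simple s \<and> normalized s) \<and>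
     (\<forall>s\<in>S. \<forall>t\<in>S. \<forall>V. simple_with_support V s \<and> simple_with_support V t \<longrightarrow> s = t) \<and>
     (\<forall>h\<in>#H. E_irreducible h \<and> normalized h) \<and>
     f = u * \<Prod>S * prod_mset H)"

definition conjecture_F :: bool where
  "conjecture_F \<longleftrightarrow> (\<forall>f. E_function f \<and> f \<noteq> 0 \<longrightarrow> (\<exists>!F. E_factorization f F))"

definition conjecture_I :: bool where
  "conjecture_I \<longleftrightarrow>
     (\<forall>h1 h2. E_irreducible h1 \<and> E_irreducible h2 \<and>
        (\<exists>\<xi>. eval_fps h1 \<xi> = 0 \<and> eval_fps h2 \<xi> = 0) \<longrightarrow> (\<exists>u. E_unit u \<and> h1 = u * h2))"

definition conjecture_Z :: bool where
  "conjecture_Z \<longleftrightarrow>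
     (\<forall>\<xi>. \<xi> \<noteq> 0 \<and> (\<exists>\<beta>. algebraic \<beta> \<and> \<beta> \<noteq> 0 \<and> algebraic (exp (\<beta> * \<xi>))) \<longrightarrow>
        (\<forall>h. E_irreducible h \<longrightarrow> eval_fps h \<xi> \<noteq> 0))"


section \<open>The gcd of two E-functions\<close>

text \<open>The definitions in this section are meaningful under \<^const>\<open>conjecture_F\<close>.\<close>

definition the_factorization ::
    "complex fps \<Rightarrow> complex fps \<times> complex fps set \<times> complex fps multiset" where
  "the_factorization f = (THE F. E_factorization f F)"

definition simple_part :: "complex set \<Rightarrow> complex fps \<Rightarrow> complex fps" where
  "simple_part V f = (case the_factorization f of (u, S, H) \<Rightarrow>
     if \<exists>s\<in>S. simple_with_support V s then THE s. s \<in> S \<and> simple_with_support V s else 1)"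

definition irreducible_mult :: "complex fps \<Rightarrow> complex fps \<Rightarrow> nat" where
  "irreducible_mult h f = (case the_factorization f of (u, S, H) \<Rightarrow> count H h)"

text \<open>Both products are restricted to the finitely many indices whose factor is not trivially \<open>1\<close>.\<close>

definition E_gcd :: "complex fps \<Rightarrow> complex fps \<Rightarrow> complex fps" where
  "E_gcd f1 f2 =
     (\<Prod>V | rational_line V \<and> simple_gcd (simple_part V f1) (simple_part V f2) \<noteq> 1.
        simple_gcd (simple_part V f1) (simple_part V f2)) *
     (\<Prod>h | E_irreducible h \<and> normalized h \<and> min (irreducible_mult h f1) (irreducible_mult h f2) \<noteq> 0.
        h ^ min (irreducible_mult h f1) (irreducible_mult h f2))"


section \<open>Common zeros\<close>

text \<open>
  The quotients \<open>f1 / d\<close> and \<open>f2 / d\<close> are required to be exact and entire, so that their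
  zeros in the complex plane make sense; \<^const>\<open>eval_fps\<close> is not meaningful outside the disc of convergence.
\<close>

definition quotients_without_common_zero :: "complex fps \<Rightarrow> complex fps \<Rightarrow> complex fps \<Rightarrow> bool" where
  "quotients_without_common_zero f1 f2 d \<longleftrightarrow>
     d dvd f1 \<and> d dvd f2 \<and>
     fps_conv_radius d = \<infinity> \<and> fps_conv_radius (f1 / d) = \<infinity> \<and> fps_conv_radius (f2 / d) = \<infinity> \<and>
     \<not> (\<exists>\<xi>. eval_fps (f1 / d) \<xi> = 0 \<and> eval_fps (f2 / d) \<xi> = 0)"

definition common_zeros_with_min_order :: "complex fps \<Rightarrow> complex fps \<Rightarrow> complex fps \<Rightarrow> bool" where
  "common_zeros_with_min_order f1 f2 d \<longleftrightarrow>
     {\<xi>. eval_fps f1 \<xi> = 0 \<and> eval_fps f2 \<xi> = 0} = {\<xi>. eval_fps d \<xi> = 0} \<and>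
     (\<forall>\<xi>. eval_fps d \<xi> = 0 \<longrightarrow>
        zorder (eval_fps d) \<xi> = min (zorder (eval_fps f1) \<xi>) (zorder (eval_fps f2) \<xi>))"

end

theory Submission
  imports Defs "Jordan_Normal_Form.Char_Poly"
begin

text \<open>
  A simple \<open>E\<close>-function is, up to a unit and a power of \<open>x\<close>, a polynomial in \<open>exp (\<beta> * x)\<close>. For two
  of them with the same support, the claim is Bezout's identity for the polynomials divided by their
  gcd. If the supports differ, a common zero \<open>\<xi>\<close> would make \<open>exp (a * \<xi>)\<close> and \<open>exp (b * \<xi>)\<close>
  algebraic for algebraic \<open>a, b\<close> that are linearly independent over the rationals, against the
  Gelfond--Schneider theorem, for which Gelfond's method is used. The same theorem shows that a
  simple function has only one support, since every simple function has a zero. For general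
  \<open>E\<close>-functions, the factorizations are compared factor by factor: conjecture Z separates the
  simple from the irreducible factors, and conjecture I, with the uniqueness in conjecture F,
  separates distinct irreducible factors.

  Algebraic integers are handled as eigenvalues: \<open>\<theta>\<close> acts on a finite family \<open>v\<close> of complex numbers
  by an integer matrix. The largest absolute row sum is submultiplicative and bounds all
  conjugates of \<open>\<theta>\<close>, so it replaces the house of \<open>\<theta>\<close>, and no number field has to be constructed.
\<close>

section \<open>Integer matrices and algebraic numbers\<close>

unbundle no vec_syntax
unbundle no fps_syntax

text \<open>A common zero \<xi> of two simple functions is only known to be a non-zero complex
  number, so the transcendence argument has to keep \<xi> arbitrary and separate its powers from the
  algebraic quantities. The family \<open>v\<close> may be linearly dependent. Then a matrix of
  \<theta> is not unique, and its characteristic polynomial can have roots that are not conjugates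
  of \<theta>. A lower bound for the modulus of \<theta> still results, because it only takes some
  monic integer polynomial that has the root \<theta> and only roots of bounded size. Its degree is
  the size of the family, which is fixed before the parameters of the auxiliary function are chosen.
  On the side of the gcd, everything is expressed by a pair of entire cofactors without common zero.
  Such a pair is found for every admissible representation of two simple functions, so different
  outcomes of the choice in \<open>simple_gcd\<close> never have to be compared.\<close>

definition house_le :: "nat set \<Rightarrow> (nat \<Rightarrow> complex) \<Rightarrow> complex \<Rightarrow> nat \<Rightarrow> bool" where
  "house_le I v \<theta> R \<longleftrightarrow>
     (\<exists>M :: nat \<Rightarrow> nat \<Rightarrow> int. (\<forall>i\<in>I. \<theta> * v i = (\<Sum>j\<in>I. of_int (M i j) * v j)) \<and>
        (\<forall>i\<in>I. (\<Sum>j\<in>I. \<bar>M i j\<bar>) \<le> int R))"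

definition generating_family :: "nat set \<Rightarrow> (nat \<Rightarrow> complex) \<Rightarrow> bool" where
  "generating_family I v \<longleftrightarrow> finite I \<and> (\<exists>i\<in>I. v i \<noteq> 0)"

lemma house_le_exI:
  assumes "finite I" "\<And>i. i \<in> I \<Longrightarrow> \<theta> * v i = (\<Sum>j\<in>I. of_int (M i j) * v j)"
  shows "\<exists>R. house_le I v \<theta> R"
proof -
  define R where "R = nat (\<Sum>i\<in>I. \<Sum>j\<in>I. \<bar>M i j\<bar>)"
  have "(\<Sum>j\<in>I. \<bar>M i j\<bar>) \<le> int R" if "i \<in> I" for i
    unfolding R_def using member_le_sum[OF that, of "\<lambda>i. \<Sum>j\<in>I. \<bar>M i j\<bar>"] assms(1)
    by (simp add: sum_nonneg)
  thus ?thesis unfolding house_le_def using assms(2) by blast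
qed

lemma house_le_mono: "house_le I v \<theta> R \<Longrightarrow> R \<le> R' \<Longrightarrow> house_le I v \<theta> R'"
  unfolding house_le_def by (meson of_nat_mono order_trans)

lemma house_le_add:
  assumes "house_le I v \<theta> R" "house_le I v \<theta>' R'"
  shows "house_le I v (\<theta> + \<theta>') (R + R')"
proof -
  from assms obtain M M' where M:
    "\<forall>i\<in>I. \<theta> * v i = (\<Sum>j\<in>I. of_int (M i j) * v j)" "\<forall>i\<in>I. (\<Sum>j\<in>I. \<bar>M i j\<bar>) \<le> int R"
    "\<forall>i\<in>I. \<theta>' * v i = (\<Sum>j\<in>I. of_int (M' i j) * v j)" "\<forall>i\<in>I. (\<Sum>j\<in>I. \<bar>M' i j\<bar>) \<le> int R'"
    unfolding house_le_def by blast
  have "(\<Sum>j\<in>I. \<bar>M i j + M' i j\<bar>) \<le> int (R + R')" if "i \<in> I" for i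
  proof -
    have "(\<Sum>j\<in>I. \<bar>M i j + M' i j\<bar>) \<le> (\<Sum>j\<in>I. \<bar>M i j\<bar> + \<bar>M' i j\<bar>)"
      by (intro sum_mono) auto
    thus ?thesis using M that by (fastforce simp: sum.distrib)
  qed
  moreover have "\<forall>i\<in>I. (\<theta> + \<theta>') * v i = (\<Sum>j\<in>I. of_int (M i j + M' i j) * v j)"
    using M by (simp add: sum.distrib algebra_simps)
  ultimately show ?thesis unfolding house_le_def by (intro exI[of _ "\<lambda>i j. M i j + M' i j"]) blast
qed

lemma house_le_mult:
  assumes "house_le I v \<theta> R" "house_le I v \<theta>' R'"
  shows "house_le I v (\<theta> * \<theta>') (R * R')"
proof -
  from assms obtain M M' where M:
    "\<forall>i\<in>I. \<theta> * v i = (\<Sum>j\<in>I. of_int (M i j) * v j)" "\<forall>i\<in>I. (\<Sum>j\<in>I. \<bar>M i j\<bar>) \<le> int R"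
    "\<forall>i\<in>I. \<theta>' * v i = (\<Sum>j\<in>I. of_int (M' i j) * v j)" "\<forall>i\<in>I. (\<Sum>j\<in>I. \<bar>M' i j\<bar>) \<le> int R'"
    unfolding house_le_def by blast
  define N where "N = (\<lambda>i l. \<Sum>j\<in>I. M i j * M' j l)"
  have "(\<Sum>l\<in>I. \<bar>N i l\<bar>) \<le> int (R * R')" if "i \<in> I" for i
  proof -
    have "(\<Sum>l\<in>I. \<bar>N i l\<bar>) \<le> (\<Sum>l\<in>I. \<Sum>j\<in>I. \<bar>M i j\<bar> * \<bar>M' j l\<bar>)"
      unfolding N_def by (intro sum_mono order_trans[OF sum_abs]) (simp add: abs_mult)
    also have "\<dots> = (\<Sum>j\<in>I. \<bar>M i j\<bar> * (\<Sum>l\<in>I. \<bar>M' j l\<bar>))"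
      by (subst sum.swap) (simp add: sum_distrib_left)
    also have "\<dots> \<le> (\<Sum>j\<in>I. \<bar>M i j\<bar> * int R')"
      using M by (intro sum_mono mult_left_mono) auto
    also have "\<dots> = (\<Sum>j\<in>I. \<bar>M i j\<bar>) * int R'" by (simp add: sum_distrib_right)
    also have "\<dots> \<le> int R * int R'" using M that by (intro mult_right_mono) auto
    finally show ?thesis by simp
  qed
  moreover have "\<theta> * \<theta>' * v i = (\<Sum>l\<in>I. of_int (N i l) * v l)" if "i \<in> I" for i
  proof -
    have "\<theta> * \<theta>' * v i = \<theta>' * (\<Sum>j\<in>I. of_int (M i j) * v j)"
      using M that by (metis mult.assoc mult.commute)
    also have "\<dots> = (\<Sum>j\<in>I. of_int (M i j) * (\<Sum>l\<in>I. of_int (M' j l) * v l))"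
      unfolding sum_distrib_left[of \<theta>'] using M(3) by (intro sum.cong refl) (metis mult.left_commute)
    also have "\<dots> = (\<Sum>l\<in>I. of_int (N i l) * v l)"
      unfolding N_def sum_distrib_left by (subst sum.swap) (simp add: sum_distrib_right mult.assoc)
    finally show ?thesis .
  qed
  ultimately show ?thesis unfolding house_le_def by (intro exI[of _ N]) blast
qed

lemma house_le_of_int:
  assumes "finite I"
  shows "house_le I v (of_int n) (nat \<bar>n\<bar>)"
proof -
  define M where "M = (\<lambda>i j::nat. if i = j then n else 0)"
  have "(\<Sum>j\<in>I. of_int (M i j) * v j) = of_int n * v i" if "i \<in> I" for i
  proof -
    have "(\<Sum>j\<in>I. of_int (M i j) * v j) = (\<Sum>j\<in>I. if i = j then of_int n * v j else 0)"
      by (intro sum.cong) (auto simp: M_def)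
    thus ?thesis using assms that by simp
  qed
  moreover have "(\<Sum>j\<in>I. \<bar>M i j\<bar>) = \<bar>n\<bar>" if "i \<in> I" for i
  proof -
    have "(\<Sum>j\<in>I. \<bar>M i j\<bar>) = (\<Sum>j\<in>I. if i = j then \<bar>n\<bar> else 0)"
      by (intro sum.cong) (auto simp: M_def)
    thus ?thesis using assms that by simp
  qed
  ultimately show ?thesis unfolding house_le_def by (intro exI[of _ M]) auto
qed

lemma house_le_of_nat: "finite I \<Longrightarrow> house_le I v (of_nat n) n"
  using house_le_of_int[of I v "int n"] by simp

lemma house_le_power:
  assumes "finite I" "house_le I v \<theta> R"
  shows "house_le I v (\<theta> ^ k) (R ^ k)"
proof (induction k)
  case 0
  show ?case using house_le_of_nat[OF assms(1), of v 1] by simp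
next
  case (Suc k)
  thus ?case using house_le_mult[OF assms(2) Suc] by simp
qed

lemma house_le_sum:
  assumes "finite I" "finite S" "\<And>s. s \<in> S \<Longrightarrow> house_le I v (f s) (R s)"
  shows "house_le I v (\<Sum>s\<in>S. f s) (\<Sum>s\<in>S. R s)"
  using assms(2,3)
proof (induction S rule: finite_induct)
  case empty
  show ?case using house_le_of_nat[OF assms(1), of v 0] by simp
next
  case (insert x S)
  thus ?case by (auto intro!: house_le_add)
qed

section \<open>Eigenvalues and Liouville's inequality\<close>

text \<open>Read \<open>A w = z w\<close> in a coordinate of \<open>w\<close> of largest
  modulus.\<close>

lemma eigenvalue_norm_le_row_sum:
  fixes A :: "complex mat"
  assumes A: "A \<in> carrier_mat n n" and ev: "eigenvalue A z"
    and R: "\<And>i. i < n \<Longrightarrow> (\<Sum>j<n. norm (A $$ (i, j))) \<le> R"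
  shows "norm z \<le> R"
proof -
  from ev obtain w where w: "w \<in> carrier_vec n" "w \<noteq> 0\<^sub>v n" "A *\<^sub>v w = z \<cdot>\<^sub>v w"
    using A unfolding eigenvalue_def eigenvector_def by auto
  have n: "n > 0" using w by (cases n) auto
  define m where "m = Max ((\<lambda>i. norm (w $ i)) ` {..<n})"
  have "m \<in> (\<lambda>i. norm (w $ i)) ` {..<n}" unfolding m_def using n by (intro Max_in) auto
  then obtain i where i: "i < n" "m = norm (w $ i)" by auto
  have m: "norm (w $ j) \<le> m" if "j < n" for j unfolding m_def using that by (intro Max_ge) auto
  have mpos: "m > 0"
  proof (rule ccontr)
    assume "\<not> m > 0"
    hence "norm (w $ j) \<le> 0" if "j < n" for j using m[OF that] by linarith
    hence "w = 0\<^sub>v n" using w(1) by (intro eq_vecI) auto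
    thus False using w by simp
  qed
  have "z * w $ i = (A *\<^sub>v w) $ i" using w i by simp
  also have "\<dots> = (\<Sum>j<n. A $$ (i, j) * w $ j)"
    using A w(1) i(1) by (simp add: scalar_prod_def atLeast0LessThan)
  finally have "norm z * m = norm (\<Sum>j<n. A $$ (i, j) * w $ j)"
    using i by (metis norm_mult)
  also have "\<dots> \<le> (\<Sum>j<n. norm (A $$ (i, j)) * m)"
    by (intro sum_norm_le) (simp add: norm_mult m mult_left_mono)
  also have "\<dots> = (\<Sum>j<n. norm (A $$ (i, j))) * m" by (simp add: sum_distrib_right)
  also have "\<dots> \<le> R * m" using R[OF i(1)] mpos by (intro mult_right_mono) auto
  finally show ?thesis using mpos by simp
qed

text \<open>The family \<open>v\<close>, enumerated by \<open>e\<close>, is an eigenvector for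
  \<theta>, so the characteristic polynomial has the root \<theta>; all its roots are eigenvalues of
  the same matrix and obey the same row-sum bound.\<close>

lemma house_le_char_poly:
  assumes gf: "generating_family I v" and h: "house_le I v \<theta> R"
  obtains G :: "int poly" where "lead_coeff G = 1" "degree G = card I"
    "poly (of_int_poly G) \<theta> = 0" "\<And>z :: complex. poly (of_int_poly G) z = 0 \<Longrightarrow> norm z \<le> R"
proof -
  from gf have fin: "finite I" and "\<exists>i\<in>I. v i \<noteq> 0" by (auto simp: generating_family_def)
  then obtain i0 where i0: "i0 \<in> I" "v i0 \<noteq> 0" by blast
  from h obtain M where M:
    "\<forall>i\<in>I. \<theta> * v i = (\<Sum>j\<in>I. of_int (M i j) * v j)" "\<forall>i\<in>I. (\<Sum>j\<in>I. \<bar>M i j\<bar>) \<le> int R"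
    unfolding house_le_def by blast
  define n where "n = card I"
  obtain e where "bij_betw e {0..<card I} I" using ex_bij_betw_nat_finite[OF fin] by blast
  hence e: "bij_betw e {..<n} I" by (simp add: n_def atLeast0LessThan)
  have eI: "e i \<in> I" if "i < n" for i using e that by (auto simp: bij_betw_def)
  define A :: "int mat" where "A = mat n n (\<lambda>(i, j). M (e i) (e j))"
  have A: "A \<in> carrier_mat n n" by (simp add: A_def)
  define B :: "complex mat" where "B = map_mat of_int A"
  have B: "B \<in> carrier_mat n n" using A by (simp add: B_def)
  have B_entry: "B $$ (i, j) = of_int (M (e i) (e j))" if "i < n" "j < n" for i j
    using that by (simp add: A_def B_def)
  have B_char: "char_poly B = of_int_poly (char_poly A)"
    unfolding B_def by (rule of_int_hom.char_poly_hom[OF A])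
  have reindex: "(\<Sum>j<n. f (e j)) = (\<Sum>j\<in>I. f j)" for f :: "nat \<Rightarrow> 'a::comm_monoid_add"
    by (rule sum.reindex_bij_betw[OF e])
  define w where "w = vec n (\<lambda>i. v (e i))"
  have "B *\<^sub>v w = \<theta> \<cdot>\<^sub>v w"
  proof (rule eq_vecI)
    fix i assume "i < dim_vec (\<theta> \<cdot>\<^sub>v w)"
    hence i: "i < n" by (simp add: w_def)
    have "(B *\<^sub>v w) $ i = (\<Sum>j<n. of_int (M (e i) (e j)) * v (e j))"
      using i B by (simp add: scalar_prod_def w_def B_entry atLeast0LessThan)
    also have "\<dots> = \<theta> * v (e i)"
      using M(1) eI[OF i] reindex[of "\<lambda>j. of_int (M (e i) j) * v j"] by simp
    finally show "(B *\<^sub>v w) $ i = (\<theta> \<cdot>\<^sub>v w) $ i" using i by (simp add: w_def)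
  qed (use B in \<open>simp add: w_def\<close>)
  moreover have "w \<noteq> 0\<^sub>v n"
  proof -
    from i0 e obtain k where "k < n" "e k = i0" by (auto simp: bij_betw_def)
    hence "w $ k \<noteq> 0" using i0 by (simp add: w_def)
    thus ?thesis using \<open>k < n\<close> by auto
  qed
  ultimately have "eigenvalue B \<theta>"
    unfolding eigenvalue_def eigenvector_def using B by (intro exI[of _ w]) (auto simp: w_def)
  hence root: "poly (of_int_poly (char_poly A)) \<theta> = 0"
    using eigenvalue_root_char_poly[OF B] B_char by simp
  have bound: "norm z \<le> R" if "poly (of_int_poly (char_poly A)) z = 0" for z :: complex
  proof (rule eigenvalue_norm_le_row_sum[OF B])
    show "eigenvalue B z" using eigenvalue_root_char_poly[OF B] B_char that by simp
    fix i assume i: "i < n"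
    have "(\<Sum>j<n. norm (B $$ (i, j))) = (\<Sum>j<n. real_of_int \<bar>M (e i) (e j)\<bar>)"
      using i by (intro sum.cong) (auto simp: B_entry)
    also have "\<dots> = real_of_int (\<Sum>j\<in>I. \<bar>M (e i) j\<bar>)"
      using reindex[of "\<lambda>j. real_of_int \<bar>M (e i) j\<bar>"] by simp
    also have "\<dots> \<le> real R" using M(2) eI[OF i] by (metis of_int_le_iff of_int_of_nat_eq)
    finally show "(\<Sum>j<n. norm (B $$ (i, j))) \<le> real R" .
  qed
  show ?thesis
    using that[of "char_poly A"] degree_monic_char_poly[OF A] root bound by (auto simp: n_def)
qed

lemma house_le_norm_le:
  assumes "generating_family I v" "house_le I v \<theta> R"
  shows "norm \<theta> \<le> R"
  using house_le_char_poly[OF assms] by metis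

lemma norm_prod_list_le:
  fixes xs :: "complex list"
  assumes "\<And>x. x \<in> set xs \<Longrightarrow> norm x \<le> R"
  shows "norm (prod_list xs) \<le> R ^ length xs"
  using assms
proof (induction xs)
  case (Cons x xs)
  have "0 \<le> R" using Cons.prems[of x] norm_ge_zero[of x] by (simp del: norm_ge_zero)
  thus ?case using Cons by (auto simp: norm_mult intro!: mult_mono)
qed simp

text \<open>Liouville's inequality: the product of the non-zero roots of a monic integer polynomial
  is, up to sign, a non-zero integer. One of them is \<theta>, and the others contribute at most
  \<open>R\<close> each.\<close>

lemma house_le_lower_bound:
  assumes gf: "generating_family I v" and h: "house_le I v \<theta> R" and nz: "\<theta> \<noteq> 0"
  shows "1 \<le> norm \<theta> * real R ^ card I"
proof -
  obtain G :: "int poly" where G: "lead_coeff G = 1" "degree G = card I"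
    "poly (of_int_poly G) \<theta> = 0" "\<And>z :: complex. poly (of_int_poly G) z = 0 \<Longrightarrow> norm z \<le> R"
    using house_le_char_poly[OF gf h] by blast
  \<comment> \<open>This permits the cruder exponent \<open>card I\<close> in place of the number of
    remaining roots.\<close>
  have R1: "real R \<ge> 1"
  proof -
    have "real R > 0" using house_le_norm_le[OF gf h] nz by (meson less_le_trans zero_less_norm_iff)
    thus ?thesis by simp
  qed
  have "G \<noteq> 0" using G(1) by auto
  \<comment> \<open>The characteristic polynomial may vanish at 0; splitting off the power of
    \<open>X\<close> leaves a factor with non-zero constant term that still has the root
    \<theta>.\<close>
  from order_decomp[OF this, of 0] obtain k p where p: "G = [:0, 1:] ^ k * p" "\<not> [:0, 1:] dvd p"
    by auto
  have p0: "coeff p 0 \<noteq> 0" using p(2) poly_eq_0_iff_dvd[of p 0] by (simp add: poly_0_coeff_0)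
  have lp: "lead_coeff p = 1"
  proof -
    have "lead_coeff G = lead_coeff ([:0, 1:] ^ k) * lead_coeff p"
      unfolding p(1) by (rule lead_coeff_mult)
    thus ?thesis using G(1) by (simp add: lead_coeff_power)
  qed
  have pz: "p \<noteq> 0" using lp by auto
  have "degree G = k + degree p"
    unfolding p(1) by (subst degree_mult_eq) (use pz in \<open>simp_all add: degree_power_eq\<close>)
  hence degp: "degree p \<le> card I" using G(2) by simp
  define P where "P = (of_int_poly p :: complex poly)"
  have P: "of_int_poly G = [:0, 1:] ^ k * P"
    unfolding P_def p(1) by (simp add: of_int_poly_hom.hom_mult of_int_poly_hom.hom_power)
  have degP: "degree P = degree p" and lP: "lead_coeff P = 1" using lp by (simp_all add: P_def)
  have root: "poly P \<theta> = 0" using G(3) nz by (simp add: P)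
  obtain as where as: "Polynomial.smult (coeff P (degree P)) (\<Prod>a\<leftarrow>as. [:- a, 1:]) = P" "length as = degree P"
    using fundamental_theorem_algebra_factorized[of P] by blast
  hence Pas: "P = (\<Prod>a\<leftarrow>as. [:- a, 1:])" using lP by simp
  have Pz: "poly P z = (\<Prod>a\<leftarrow>as. z - a)" for z
    unfolding Pas by (induction as) (auto simp: algebra_simps)
  have "\<theta> \<in> set as" using root by (auto simp: Pz)
  then obtain xs ys where xy: "as = xs @ \<theta> # ys" by (meson split_list)
  have le: "norm a \<le> R" if "a \<in> set as" for a
  proof -
    have "poly P a = 0" using that by (auto simp: Pz)
    thus ?thesis using G(4)[of a] by (simp add: P)
  qed
  have "norm (poly P 0) = norm (prod_list as)"
    unfolding Pz by (induction as) (auto simp: norm_mult)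
  also have "\<dots> = norm \<theta> * norm (prod_list (xs @ ys))" by (simp add: xy norm_mult)
  also have "\<dots> \<le> norm \<theta> * real R ^ length (xs @ ys)"
    using le xy by (intro mult_left_mono norm_prod_list_le) auto
  also have "\<dots> \<le> norm \<theta> * real R ^ card I"
    using R1 xy as(2) degP degp by (intro mult_left_mono power_increasing) auto
  finally have "norm (poly P 0) \<le> norm \<theta> * real R ^ card I" .
  moreover have "norm (poly P 0) \<ge> 1"
    using p0 by (simp add: P_def poly_0_coeff_0)
  ultimately show ?thesis by simp
qed

lemma house_le_imp_algebraic_int:
  assumes "generating_family I v" "house_le I v \<theta> R"
  shows "algebraic_int \<theta>"
proof -
  obtain G :: "int poly" where "lead_coeff G = 1" "poly (of_int_poly G) \<theta> = 0"
    using house_le_char_poly[OF assms] by blast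
  thus ?thesis unfolding algebraic_int_altdef_ipoly by blast
qed

text \<open>The new family consists of the products \<open>v i * w ^ k\<close> with
  \<open>k < d\<close>. Multiplication by \<open>w\<close> raises \<open>k\<close> by one, and the
  relation for \<open>w ^ d\<close> absorbs the top power; since the \<open>c k\<close> act on
  \<open>v\<close> by integer matrices, \<open>w\<close> acts on the products by one.\<close>

lemma house_le_adjoin:
  fixes w :: complex
  assumes gf: "generating_family I v" and d: "d > 0"
    and w: "w ^ d = (\<Sum>k<d. c k * w ^ k)" and c: "\<And>k. k < d \<Longrightarrow> \<exists>R. house_le I v (c k) R"
  obtains I' v' where "generating_family I' v'"
    "\<And>\<theta> R. house_le I v \<theta> R \<Longrightarrow> house_le I' v' \<theta> R" "\<exists>R. house_le I' v' w R"
proof -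
  from gf have fin: "finite I" and "\<exists>i\<in>I. v i \<noteq> 0" by (auto simp: generating_family_def)
  then obtain i0 where i0: "i0 \<in> I" "v i0 \<noteq> 0" by blast
  define J where "J = I \<times> {..<d}"
  have finJ: "finite J" using fin by (simp add: J_def)
  \<comment> \<open>Pairs are encoded as natural numbers, so the index type stays the same when the
    construction is iterated.\<close>
  define I' where "I' = prod_encode ` J"
  define v' where "v' = (\<lambda>x. case prod_decode x of (i, k) \<Rightarrow> v i * w ^ k)"
  have v'[simp]: "v' (prod_encode (i, k)) = v i * w ^ k" for i k by (simp add: v'_def)
  have reindex: "(\<Sum>x\<in>I'. f x) = (\<Sum>i\<in>I. \<Sum>k<d. f (prod_encode (i, k)))" for f :: "nat \<Rightarrow> 'a::comm_monoid_add"
    unfolding I'_def J_def by (subst sum.reindex) (auto simp: inj_prod_encode sum.cartesian_product)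
  have gf': "generating_family I' v'"
    unfolding generating_family_def
  proof
    show "finite I'" using finJ by (simp add: I'_def)
    have "prod_encode (i0, 0) \<in> I'" using i0 d by (auto simp: I'_def J_def)
    thus "\<exists>i\<in>I'. v' i \<noteq> 0" using i0 by (intro bexI[of _ "prod_encode (i0, 0)"]) auto
  qed
  have old: "house_le I' v' \<theta> R" if \<theta>: "house_le I v \<theta> R" for \<theta> R
  proof -
    from \<theta> obtain M where M:
      "\<forall>i\<in>I. \<theta> * v i = (\<Sum>j\<in>I. of_int (M i j) * v j)" "\<forall>i\<in>I. (\<Sum>j\<in>I. \<bar>M i j\<bar>) \<le> int R"
      unfolding house_le_def by blast
    \<comment> \<open>Block diagonal, with one copy of \<open>M\<close> for each power of
      \<open>w\<close>, hence with the same row sums.\<close>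
    define N where "N = (\<lambda>x y. case prod_decode x of (i, k) \<Rightarrow> case prod_decode y of (j, l) \<Rightarrow>
                           if k = l then M i j else 0)"
    have N[simp]: "N (prod_encode (i, k)) (prod_encode (j, l)) = (if k = l then M i j else 0)" for i j k l
      by (simp add: N_def)
    show ?thesis unfolding house_le_def
    proof (intro exI[of _ N] conjI ballI)
      fix x assume "x \<in> I'"
      then obtain i k where ik: "x = prod_encode (i, k)" "i \<in> I" "k < d" by (auto simp: I'_def J_def)
      have "(\<Sum>y\<in>I'. of_int (N x y) * v' y) = (\<Sum>j\<in>I. \<Sum>l<d. if k = l then of_int (M i j) * v j * w ^ l else 0)"
        unfolding reindex ik by (intro sum.cong) auto
      also have "\<dots> = (\<Sum>j\<in>I. of_int (M i j) * v j) * w ^ k" using ik by (simp add: sum_distrib_right)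
      finally show "\<theta> * v' x = (\<Sum>y\<in>I'. of_int (N x y) * v' y)"
        using M(1) ik by (simp add: mult.assoc)
      have "(\<Sum>y\<in>I'. \<bar>N x y\<bar>) = (\<Sum>j\<in>I. \<Sum>l<d. if k = l then \<bar>M i j\<bar> else 0)"
        unfolding reindex ik by (intro sum.cong) auto
      thus "(\<Sum>y\<in>I'. \<bar>N x y\<bar>) \<le> int R" using M(2) ik by simp
    qed
  qed
  have "\<forall>k. \<exists>M :: nat \<Rightarrow> nat \<Rightarrow> int. k < d \<longrightarrow> (\<forall>i\<in>I. c k * v i = (\<Sum>j\<in>I. of_int (M i j) * v j))"
    using c unfolding house_le_def by blast
  then obtain C :: "nat \<Rightarrow> nat \<Rightarrow> nat \<Rightarrow> int"
    where C: "\<And>k i. k < d \<Longrightarrow> i \<in> I \<Longrightarrow> c k * v i = (\<Sum>j\<in>I. of_int (C k i j) * v j)" by metis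
  \<comment> \<open>Block companion matrix; its last block row consists of the matrices of the
    \<open>c l\<close>.\<close>
  define N where "N = (\<lambda>x y. case prod_decode x of (i, k) \<Rightarrow> case prod_decode y of (j, l) \<Rightarrow>
                         if Suc k < d then (if l = Suc k \<and> i = j then 1 else 0) else C l i j)"
  have N[simp]: "N (prod_encode (i, k)) (prod_encode (j, l)) =
      (if Suc k < d then (if l = Suc k \<and> i = j then 1 else 0) else C l i j)" for i j k l
    by (simp add: N_def)
  have "w * v' x = (\<Sum>y\<in>I'. of_int (N x y) * v' y)" if "x \<in> I'" for x
  proof -
    from that obtain i k where ik: "x = prod_encode (i, k)" "i \<in> I" "k < d" by (auto simp: I'_def J_def)
    show ?thesis
    proof (cases "Suc k < d")
      case True
      have "(\<Sum>y\<in>I'. of_int (N x y) * v' y) =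
            (\<Sum>j\<in>I. \<Sum>l<d. if l = Suc k then (if i = j then v j * w ^ l else 0) else 0)"
        unfolding reindex ik using True by (intro sum.cong) auto
      also have "\<dots> = (\<Sum>j\<in>I. if i = j then v j * w ^ Suc k else 0)" using True by simp
      finally show ?thesis using True ik fin by simp
    next
      case False
      hence k: "Suc k = d" using ik by simp
      have "(\<Sum>y\<in>I'. of_int (N x y) * v' y) = (\<Sum>j\<in>I. \<Sum>l<d. of_int (C l i j) * v j * w ^ l)"
        unfolding reindex ik using False by (intro sum.cong) auto
      also have "\<dots> = (\<Sum>l<d. (c l * v i) * w ^ l)"
        by (subst sum.swap) (use ik in \<open>simp add: C sum_distrib_right\<close>)
      also have "\<dots> = w ^ d * v i" unfolding w by (simp add: sum_distrib_right sum_distrib_left mult_ac)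
      also have "\<dots> = w * v' x" unfolding k[symmetric] ik(1) by (simp add: mult_ac)
      finally show ?thesis ..
    qed
  qed
  hence "\<exists>R. house_le I' v' w R"
    using gf' by (intro house_le_exI[where M = N]) (auto simp: generating_family_def)
  with gf' old that show ?thesis by blast
qed

section \<open>The ring of algebraic integers\<close>

lemma algebraic_int_monic_sum:
  fixes x :: complex
  assumes "algebraic_int x"
  obtains d c where "d > 0" "x ^ d = (\<Sum>k<d. of_int (c k) * x ^ k)"
proof -
  from assms obtain p :: "int poly" where p: "lead_coeff p = 1" "poly (of_int_poly p) x = 0"
    unfolding algebraic_int_altdef_ipoly by blast
  have "degree p > 0"
  proof (rule ccontr)
    assume "\<not> degree p > 0"
    hence "p = 1" using p(1) by (metis degree_eq_zeroE gr0I lead_coeff_pCons(2) one_pCons)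
    thus False using p(2) by simp
  qed
  moreover have "x ^ degree p = (\<Sum>k<degree p. of_int (- coeff p k) * x ^ k)"
  proof -
    have "0 = (\<Sum>k\<le>degree p. of_int (coeff p k) * x ^ k)"
      using p(2) by (simp add: poly_altdef)
    also have "\<dots> = (\<Sum>k<degree p. of_int (coeff p k) * x ^ k) + x ^ degree p"
      using p(1) by (simp flip: lessThan_Suc_atMost)
    finally show ?thesis by (simp add: sum_negf eq_neg_iff_add_eq_0 add.commute)
  qed
  ultimately show ?thesis using that[of "degree p" "\<lambda>k. - coeff p k"] by simp
qed

text \<open>Bounds can be added and multiplied only with respect to one family. Starting from the
  single number 1, the elements are adjoined one after another.\<close>

lemma algebraic_int_common_family:
  assumes "finite X" "\<And>x. x \<in> X \<Longrightarrow> algebraic_int x"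
  obtains I v where "generating_family I v" "\<And>x. x \<in> X \<Longrightarrow> \<exists>R. house_le I v x R"
proof -
  have "\<exists>I v. generating_family I v \<and> (\<forall>x\<in>X. \<exists>R. house_le I v x R)"
    using assms
  proof (induction X rule: finite_induct)
    case empty
    have "generating_family {0} (\<lambda>_. 1)" by (simp add: generating_family_def)
    thus ?case by blast
  next
    case (insert x X)
    then obtain I v where Iv: "generating_family I v" "\<forall>x\<in>X. \<exists>R. house_le I v x R" by auto
    have "algebraic_int x" using insert by simp
    then obtain d c where d: "d > 0" "x ^ d = (\<Sum>k<d. of_int (c k) * x ^ k)"
      by (rule algebraic_int_monic_sum)
    have "\<exists>R. house_le I v (of_int (c k)) R" for k
      using house_le_of_int[of I] Iv(1) unfolding generating_family_def by blast
    then obtain I' v' where "generating_family I' v'"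
        "\<And>\<theta> R. house_le I v \<theta> R \<Longrightarrow> house_le I' v' \<theta> R" "\<exists>R. house_le I' v' x R"
      using house_le_adjoin[OF Iv(1) d] by blast
    thus ?case using Iv(2) by (intro exI[of _ I'] exI[of _ v']) blast
  qed
  thus ?thesis using that by blast
qed

lemma algebraic_int_add_complex:
  fixes x y :: complex
  assumes "algebraic_int x" "algebraic_int y"
  shows "algebraic_int (x + y)"
proof -
  obtain I v where "generating_family I v" "\<And>z. z \<in> {x, y} \<Longrightarrow> \<exists>R. house_le I v z R"
    using algebraic_int_common_family[of "{x, y}"] assms by auto
  thus ?thesis by (meson house_le_add house_le_imp_algebraic_int insertCI)
qed

lemma algebraic_int_mult_complex:
  fixes x y :: complex
  assumes "algebraic_int x" "algebraic_int y"
  shows "algebraic_int (x * y)"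
proof -
  obtain I v where "generating_family I v" "\<And>z. z \<in> {x, y} \<Longrightarrow> \<exists>R. house_le I v z R"
    using algebraic_int_common_family[of "{x, y}"] assms by auto
  thus ?thesis by (meson house_le_mult house_le_imp_algebraic_int insertCI)
qed

lemma algebraic_int_power_complex:
  fixes x :: complex
  assumes "algebraic_int x"
  shows "algebraic_int (x ^ n)"
  by (induction n) (auto intro: algebraic_int_mult_complex assms int_imp_algebraic_int)

lemma algebraic_int_of_nat_mult_complex:
  fixes x :: complex
  assumes "algebraic_int x"
  shows "algebraic_int (of_nat n * x)"
  by (intro algebraic_int_mult_complex assms int_imp_algebraic_int) auto

text \<open>The coefficients are placed in one family, to which \<open>w\<close> is adjoined: this
  is the transitivity of integrality.\<close>

lemma algebraic_int_root_monic:
  fixes w :: complex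
  assumes d: "d > 0" and w: "w ^ d = (\<Sum>k<d. c k * w ^ k)" and c: "\<And>k. k < d \<Longrightarrow> algebraic_int (c k)"
  shows "algebraic_int w"
proof -
  have "algebraic_int z" if "z \<in> c ` {..<d}" for z using c that by auto
  then obtain I v where "generating_family I v" "\<And>z. z \<in> c ` {..<d} \<Longrightarrow> \<exists>R. house_le I v z R"
    using algebraic_int_common_family[of "c ` {..<d}"] by blast
  then obtain I' v' where "generating_family I' v'" "\<exists>R. house_le I' v' w R"
    using house_le_adjoin[OF _ d w] by (metis imageI lessThan_iff)
  thus ?thesis using house_le_imp_algebraic_int by blast
qed

text \<open>Multiplying a vanishing relation by the \<open>(d-1)\<close>-st power of its leading coefficient makes it monic.\<close>

lemma algebraic_int_lead_mult_root:
  fixes w :: complex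
  assumes "d > 0" "(\<Sum>k\<le>d. a k * w ^ k) = 0" "\<And>k. k \<le> d \<Longrightarrow> algebraic_int (a k)"
  shows "algebraic_int (a d * w)"
proof (rule algebraic_int_root_monic[OF assms(1)])
  have "a d * w ^ d = - (\<Sum>k<d. a k * w ^ k)"
    using assms(2) by (simp add: eq_neg_iff_add_eq_0 add.commute flip: lessThan_Suc_atMost)
  moreover have "(a d * w) ^ d = a d ^ (d - 1) * (a d * w ^ d)"
    using assms(1) by (cases d) (simp_all add: power_mult_distrib mult_ac)
  ultimately have "(a d * w) ^ d = (\<Sum>k<d. - (a d ^ (d - 1) * a k * w ^ k))"
    by (simp add: sum_distrib_left sum_negf mult_ac)
  also have "\<dots> = (\<Sum>k<d. - (a d ^ (d - 1 - k) * a k) * (a d * w) ^ k)"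
  proof (intro sum.cong refl)
    fix k assume "k \<in> {..<d}"
    hence "a d ^ (d - 1) = a d ^ (d - 1 - k) * a d ^ k" by (simp flip: power_add)
    thus "- (a d ^ (d - 1) * a k * w ^ k) = - (a d ^ (d - 1 - k) * a k) * (a d * w) ^ k"
      by (simp add: power_mult_distrib mult_ac)
  qed
  finally show "(a d * w) ^ d = (\<Sum>k<d. - (a d ^ (d - 1 - k) * a k) * (a d * w) ^ k)" .
  fix k assume "k < d"
  thus "algebraic_int (- (a d ^ (d - 1 - k) * a k))"
    by (intro algebraic_int_minus algebraic_int_mult_complex algebraic_int_power_complex assms(3)) auto
qed

lemma degree_pos_if_root:
  fixes p :: "'a :: comm_ring_1 poly"
  assumes "p \<noteq> 0" "poly p x = 0"
  shows "degree p > 0"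
proof (rule ccontr)
  assume "\<not> degree p > 0"
  hence "degree p = 0" by simp
  then obtain a where "p = [:a:]" by (rule degree_eq_zeroE)
  thus False using assms by simp
qed

section \<open>Denominators and the field of algebraic numbers\<close>

lemma algebraic_denominator:
  fixes x :: complex
  assumes "algebraic x"
  obtains n :: nat where "n > 0" "algebraic_int (of_nat n * x)"
proof -
  from assms obtain p where p: "\<And>i. coeff p i \<in> \<int>" "p \<noteq> 0" "poly p x = 0"
    unfolding algebraic_def by blast
  have d: "degree p > 0" using degree_pos_if_root p by blast
  have "algebraic_int (coeff p (degree p) * x)"
    by (rule algebraic_int_lead_mult_root[OF d]) (use p in \<open>auto simp: poly_altdef int_imp_algebraic_int\<close>)
  moreover obtain l where l: "coeff p (degree p) = of_int l" using p(1) by (auto elim: Ints_cases)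
  moreover have "l \<noteq> 0" using l p by auto
  moreover have "complex_of_nat (nat \<bar>l\<bar>) * x = of_int l * x \<or> complex_of_nat (nat \<bar>l\<bar>) * x = - (of_int l * x)"
    by (cases "l \<ge> 0") auto
  ultimately have "nat \<bar>l\<bar> > 0" "algebraic_int (of_nat (nat \<bar>l\<bar>) * x)" by auto
  thus ?thesis using that by blast
qed

lemma algebraic_common_denominator:
  fixes X :: "complex set"
  assumes "finite X" "\<And>x. x \<in> X \<Longrightarrow> algebraic x"
  obtains n :: nat where "n > 0" "\<And>x. x \<in> X \<Longrightarrow> algebraic_int (of_nat n * x)"
proof -
  have "\<exists>n::nat. n > 0 \<and> (\<forall>x\<in>X. algebraic_int (of_nat n * x))"
    using assms
  proof (induction X rule: finite_induct)
    case (insert x X)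
    then obtain n :: nat where n: "n > 0" "\<forall>x\<in>X. algebraic_int (of_nat n * x)" by auto
    obtain m :: nat where m: "m > 0" "algebraic_int (of_nat m * x)"
      using insert.prems algebraic_denominator[of x] by auto
    have "algebraic_int (of_nat (m * n) * y)" if "y \<in> insert x X" for y
    proof (cases "y = x")
      case True
      thus ?thesis using algebraic_int_of_nat_mult_complex[OF m(2), of n] by (simp add: mult_ac)
    next
      case False
      hence "algebraic_int (of_nat n * y)" using that n by auto
      thus ?thesis using algebraic_int_of_nat_mult_complex[of "of_nat n * y" m] by (simp add: mult_ac)
    qed
    thus ?case using n m by (intro exI[of _ "m * n"]) auto
  qed auto
  thus ?thesis using that by blast
qed

lemma algebraic_int_of_nat_mult_imp_algebraic:
  fixes x :: complex
  assumes "algebraic_int (of_nat n * x)" "n > 0"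
  shows "algebraic x"
proof -
  obtain d c where d: "d > 0" "(of_nat n * x) ^ d = (\<Sum>k<d. of_int (c k) * (of_nat n * x) ^ k)"
    using algebraic_int_monic_sum[OF assms(1)] .
  define p where "p = monom (of_nat n ^ d) d - (\<Sum>k<d. monom (of_int (c k) * of_nat n ^ k :: complex) k)"
  have "coeff p i \<in> \<int>" for i
    unfolding p_def by (auto simp: coeff_sum intro!: Ints_diff Ints_sum Ints_mult Ints_power)
  moreover have "coeff p d = of_nat n ^ d" unfolding p_def by (simp add: coeff_sum)
  hence "p \<noteq> 0" using assms(2) by auto
  moreover have "poly p x = 0"
    unfolding p_def using d(2) by (simp add: poly_sum poly_monom power_mult_distrib mult_ac)
  ultimately show ?thesis by (rule algebraicI)
qed

lemma algebraic_add_complex: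
  fixes x y :: complex
  assumes "algebraic x" "algebraic y"
  shows "algebraic (x + y)"
proof -
  obtain n :: nat where n: "n > 0" "\<And>z. z \<in> {x, y} \<Longrightarrow> algebraic_int (of_nat n * z)"
    using algebraic_common_denominator[of "{x, y}"] assms by auto
  have "algebraic_int (of_nat n * (x + y))"
    using algebraic_int_add_complex[of "of_nat n * x" "of_nat n * y"] n by (simp add: algebra_simps)
  thus ?thesis using n(1) by (rule algebraic_int_of_nat_mult_imp_algebraic)
qed

lemma algebraic_mult_complex:
  fixes x y :: complex
  assumes "algebraic x" "algebraic y"
  shows "algebraic (x * y)"
proof -
  obtain n :: nat where n: "n > 0" "\<And>z. z \<in> {x, y} \<Longrightarrow> algebraic_int (of_nat n * z)"
    using algebraic_common_denominator[of "{x, y}"] assms by auto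
  have "algebraic_int (of_nat (n * n) * (x * y))"
    using algebraic_int_mult_complex[of "of_nat n * x" "of_nat n * y"] n by (simp add: mult_ac)
  thus ?thesis by (rule algebraic_int_of_nat_mult_imp_algebraic) (use n in auto)
qed

lemma algebraic_power_complex:
  fixes x :: complex
  shows "algebraic x \<Longrightarrow> algebraic (x ^ n)"
  by (induction n) (auto intro: algebraic_mult_complex rat_imp_algebraic)

text \<open>Once the denominators of the coefficients are cleared, the leading coefficient times
  \<open>x\<close> is an algebraic integer. This will show that \<open>exp (\<beta> * z)\<close> is
  algebraic at a zero \<open>z\<close> of a simple function.\<close>

lemma algebraic_root_of_algebraic_poly:
  assumes P: "algebraic_poly P" "P \<noteq> 0" and x: "poly P x = 0"
  shows "algebraic x"
proof -
  have d: "degree P > 0" using degree_pos_if_root P x by blast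
  obtain n :: nat where n: "n > 0" "\<And>z. z \<in> coeff P ` {..degree P} \<Longrightarrow> algebraic_int (of_nat n * z)"
    using algebraic_common_denominator[of "coeff P ` {..degree P}"] P(1)
    unfolding algebraic_poly_def by auto
  define l where "l = coeff P (degree P)"
  have l: "l \<noteq> 0" "algebraic l" using P by (auto simp: l_def algebraic_poly_def)
  have "(\<Sum>k\<le>degree P. of_nat n * coeff P k * x ^ k) = of_nat n * poly P x"
    by (simp add: poly_altdef sum_distrib_left mult_ac)
  hence "algebraic_int (of_nat n * l * x)"
    unfolding l_def using x n(2)
    by (intro algebraic_int_lead_mult_root[OF d, of "\<lambda>k. of_nat n * coeff P k"]) auto
  hence "algebraic (l * x)"
    using n(1) by (intro algebraic_int_of_nat_mult_imp_algebraic[of n]) (simp_all add: mult_ac)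
  hence "algebraic (inverse l * (l * x))" using algebraic_mult_complex algebraic_inverse l(2) by blast
  moreover have "inverse l * (l * x) = x" using l(1) by (simp add: field_simps)
  ultimately show ?thesis by metis
qed

section \<open>Entire series, Siegel's lemma and interpolation\<close>

definition entire_fps :: "complex fps \<Rightarrow> bool" where
  "entire_fps f \<longleftrightarrow> fps_conv_radius f = \<infinity>"

lemma entire_fps_const [simp]: "entire_fps (fps_const c)"
  by (simp add: entire_fps_def)

lemma entire_fps_one [simp]: "entire_fps 1"
  by (simp add: entire_fps_def)

lemma entire_fps_zero [simp]: "entire_fps 0"
  by (simp add: entire_fps_def)

lemma entire_fps_exp [simp]: "entire_fps (fps_exp a)"
  by (simp add: entire_fps_def)

lemma entire_fps_add: "entire_fps f \<Longrightarrow> entire_fps g \<Longrightarrow> entire_fps (f + g)"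
  using fps_conv_radius_add[of f g] by (simp add: entire_fps_def)

lemma entire_fps_mult: "entire_fps f \<Longrightarrow> entire_fps g \<Longrightarrow> entire_fps (f * g)"
  using fps_conv_radius_mult[of f g] by (simp add: entire_fps_def)

lemma entire_fps_shift: "entire_fps f \<Longrightarrow> entire_fps (fps_shift n f)"
  by (simp add: entire_fps_def)

lemma entire_fps_sum: "(\<And>s. s \<in> S \<Longrightarrow> entire_fps (f s)) \<Longrightarrow> entire_fps (\<Sum>s\<in>S. f s)"
  by (induction S rule: infinite_finite_induct) (auto intro: entire_fps_add)

lemma entire_fps_prod: "(\<And>s. s \<in> S \<Longrightarrow> entire_fps (f s)) \<Longrightarrow> entire_fps (\<Prod>s\<in>S. f s)"
  by (induction S rule: infinite_finite_induct) (auto intro: entire_fps_mult)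

lemma entire_fps_prod_mset: "(\<And>h. h \<in># H \<Longrightarrow> entire_fps h) \<Longrightarrow> entire_fps (prod_mset H)"
  by (induction H) (auto intro: entire_fps_mult)

lemma eval_entire_mult:
  "entire_fps f \<Longrightarrow> entire_fps g \<Longrightarrow> eval_fps (f * g) z = eval_fps f z * eval_fps g z"
  by (simp add: entire_fps_def eval_fps_mult)

lemma eval_entire_add:
  "entire_fps f \<Longrightarrow> entire_fps g \<Longrightarrow> eval_fps (f + g) z = eval_fps f z + eval_fps g z"
  by (simp add: entire_fps_def eval_fps_add)

lemma eval_entire_sum:
  "(\<And>s. s \<in> S \<Longrightarrow> entire_fps (f s)) \<Longrightarrow> eval_fps (\<Sum>s\<in>S. f s) z = (\<Sum>s\<in>S. eval_fps (f s) z)"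
  by (induction S rule: infinite_finite_induct) (auto simp: eval_entire_add entire_fps_sum)

lemma eval_entire_prod:
  "(\<And>s. s \<in> S \<Longrightarrow> entire_fps (f s)) \<Longrightarrow> eval_fps (\<Prod>s\<in>S. f s) z = (\<Prod>s\<in>S. eval_fps (f s) z)"
  by (induction S rule: infinite_finite_induct) (auto simp: eval_entire_mult entire_fps_prod)

lemma eval_entire_prod_mset:
  "(\<And>h. h \<in># H \<Longrightarrow> entire_fps h) \<Longrightarrow> eval_fps (prod_mset H) z = (\<Prod>h\<in>#H. eval_fps h z)"
  by (induction H) (auto simp: eval_entire_mult entire_fps_prod_mset)

lemma holomorphic_eval_entire: "entire_fps f \<Longrightarrow> eval_fps f holomorphic_on S"
  by (rule holomorphic_on_eval_fps) (auto simp: entire_fps_def)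

section \<open>Small integer solutions of linear systems\<close>

text \<open>Pigeonhole principle: the box of vectors with entries in \<open>{0..Y}\<close> has more
  points than there are possible value vectors, and the difference of two points with equal values
  is a solution.\<close>

lemma siegel_lemma:
  fixes A :: "'e \<Rightarrow> 's \<Rightarrow> int"
  assumes fin: "finite E" "finite S" and ne: "S \<noteq> {}" and card: "2 * card E \<le> card S" and X: "X \<ge> 1"
    and A: "\<And>e s. e \<in> E \<Longrightarrow> s \<in> S \<Longrightarrow> \<bar>A e s\<bar> \<le> int X"
  shows "\<exists>x. (\<exists>s\<in>S. x s \<noteq> 0) \<and> (\<forall>s\<in>S. \<bar>x s\<bar> \<le> int (card S * X)) \<and>
           (\<forall>e\<in>E. (\<Sum>s\<in>S. A e s * x s) = 0)"
proof -
  \<comment> \<open>\<open>Y\<close> bounds the absolute row sums, so each row takes at most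
    \<open>Y * Y + 1\<close> values on the box.\<close>
  define Y where "Y = card S * X"
  have cS: "card S > 0" using ne fin by (simp add: card_gt_0_iff)
  hence Y: "Y \<ge> 1" using X by (simp add: Y_def)
  define D where "D = PiE S (\<lambda>_. {0..int Y})"
  define \<phi> where "\<phi> = (\<lambda>y. restrict (\<lambda>e. \<Sum>s\<in>S. A e s * y s) E)"
  \<comment> \<open>\<open>L e\<close> and \<open>U e\<close> are the extreme values of row
    \<open>e\<close> on the box: unknowns with coefficients of one sign are set to \<open>Y\<close>,
    the others to 0.\<close>
  define L where "L = (\<lambda>e. \<Sum>s\<in>S. min (A e s) 0 * int Y)"
  define U where "U = (\<lambda>e. \<Sum>s\<in>S. max (A e s) 0 * int Y)"
  define T where "T = PiE E (\<lambda>e. {L e..U e})"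
  have finT: "finite T" unfolding T_def using fin by (intro finite_PiE) auto
  have cardD: "card D = (Y + 1) ^ card S" unfolding D_def using fin by (simp add: card_PiE nat_add_distrib)
  have cardT: "card T \<le> (Y * Y + 1) ^ card E"
  proof -
    have "card T = (\<Prod>e\<in>E. card {L e..U e})" unfolding T_def using fin by (simp add: card_PiE)
    also have "\<dots> \<le> (\<Prod>e\<in>E. Y * Y + 1)"
    proof (intro prod_mono conjI)
      fix e assume e: "e \<in> E"
      have "U e - L e = (\<Sum>s\<in>S. \<bar>A e s\<bar> * int Y)"
        unfolding U_def L_def sum_subtractf[symmetric] by (intro sum.cong) (auto simp: max_def min_def)
      also have "\<dots> \<le> (\<Sum>s\<in>S. int X * int Y)"
        using A[OF e] by (intro sum_mono mult_right_mono) auto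
      also have "\<dots> = int (Y * Y)" by (simp add: Y_def)
      finally have "U e - L e \<le> int (Y * Y)" .
      moreover have "card {L e..U e} = nat (U e - L e + 1)" by simp
      ultimately show "card {L e..U e} \<le> Y * Y + 1" by linarith
    qed simp
    also have "\<dots> = (Y * Y + 1) ^ card E" by simp
    finally show ?thesis .
  qed
  \<comment> \<open>With two unknowns per equation, the comparison comes down to
    \<open>Y\<^sup>2 + 1 < (Y + 1)\<^sup>2\<close>.\<close>
  have less: "(Y * Y + 1) ^ card E < (Y + 1) ^ card S"
  proof (cases "card E = 0")
    case True
    have "1 < (Y + 1) ^ card S" using cS Y by (intro one_less_power) auto
    thus ?thesis using True by simp
  next
    case False
    have "(Y * Y + 1) ^ card E < ((Y + 1) ^ 2) ^ card E"
      using False Y by (intro power_strict_mono) (auto simp: power2_eq_square)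
    also have "\<dots> = (Y + 1) ^ (2 * card E)" by (simp add: power_mult)
    also have "\<dots> \<le> (Y + 1) ^ card S" using card by (intro power_increasing) auto
    finally show ?thesis .
  qed
  have sub: "\<phi> ` D \<subseteq> T"
  proof safe
    fix y assume y: "y \<in> D"
    have "L e \<le> (\<Sum>s\<in>S. A e s * y s)" "(\<Sum>s\<in>S. A e s * y s) \<le> U e" for e
    proof -
      have ys: "0 \<le> y s \<and> y s \<le> int Y" if "s \<in> S" for s using y that by (auto simp: D_def)
      show "L e \<le> (\<Sum>s\<in>S. A e s * y s)" unfolding L_def
      proof (rule sum_mono)
        fix s assume "s \<in> S"
        show "min (A e s) 0 * int Y \<le> A e s * y s"
          using ys[OF \<open>s \<in> S\<close>] by (cases "A e s \<ge> 0") (auto simp: min_def mult_left_mono_neg)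
      qed
      show "(\<Sum>s\<in>S. A e s * y s) \<le> U e" unfolding U_def
      proof (rule sum_mono)
        fix s assume "s \<in> S"
        show "A e s * y s \<le> max (A e s) 0 * int Y"
          using ys[OF \<open>s \<in> S\<close>] by (cases "A e s \<ge> 0") (auto simp: max_def mult_left_mono mult_nonpos_nonneg)
      qed
    qed
    thus "\<phi> y \<in> T" by (auto simp: \<phi>_def T_def)
  qed
  have "\<not> inj_on \<phi> D"
  proof
    assume "inj_on \<phi> D"
    hence "card D \<le> card T" using sub finT by (rule card_inj_on_le)
    thus False using cardD cardT less by simp
  qed
  then obtain y y' where y: "y \<in> D" "y' \<in> D" "\<phi> y = \<phi> y'" "y \<noteq> y'" by (auto simp: inj_on_def)
  show ?thesis
  proof (intro exI[of _ "\<lambda>s. y s - y' s"] conjI ballI)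
    show "\<exists>s\<in>S. y s - y' s \<noteq> 0"
    proof (rule ccontr)
      assume "\<not> (\<exists>s\<in>S. y s - y' s \<noteq> 0)"
      hence "y = y'" using y(1,2) unfolding D_def by (intro PiE_ext) auto
      thus False using y by simp
    qed
    fix s assume s: "s \<in> S"
    have "y s \<in> {0..int Y}" "y' s \<in> {0..int Y}" using y s by (auto simp: D_def)
    thus "\<bar>y s - y' s\<bar> \<le> int (card S * X)" by (auto simp flip: Y_def)
  next
    fix e assume e: "e \<in> E"
    from y(3) have "\<phi> y e = \<phi> y' e" by simp
    thus "(\<Sum>s\<in>S. A e s * (y s - y' s)) = 0"
      using e by (simp add: \<phi>_def algebra_simps sum_subtractf)
  qed
qed

section \<open>Zeros of exponential sums and the maximum principle\<close>

text \<open>Expansion at \<open>t\<close> turns the sums of the hypothesis into \<open>k!\<close>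
  times the Taylor coefficients. The first \<open>r\<close> of these vanish, and the next one is the
  constant term of the shifted series.\<close>

lemma exp_sum_factor_zero:
  fixes c l :: "'s \<Rightarrow> complex"
  assumes fin: "finite S" and z: "\<And>k. k < r \<Longrightarrow> (\<Sum>s\<in>S. c s * exp (l s * t) * l s ^ k) = 0"
  obtains h where "h holomorphic_on UNIV" "\<And>z. (\<Sum>s\<in>S. c s * exp (l s * z)) = (z - t) ^ r * h z"
    "h t = (\<Sum>s\<in>S. c s * exp (l s * t) * l s ^ r) / fact r"
proof -
  define f where "f = (\<Sum>s\<in>S. fps_const (c s * exp (l s * t)) * fps_exp (l s))"
  have nth: "fps_nth f k = (\<Sum>s\<in>S. c s * exp (l s * t) * l s ^ k) / fact k" for k
    by (simp add: f_def fps_sum_nth sum_divide_distrib)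
  have ent: "entire_fps f"
    unfolding f_def by (intro entire_fps_sum entire_fps_mult) auto
  have ev: "eval_fps f w = (\<Sum>s\<in>S. c s * exp (l s * (t + w)))" for w
    unfolding f_def
    by (subst eval_entire_sum) (auto intro!: entire_fps_mult simp: eval_entire_mult algebra_simps exp_add)
  define g where "g = fps_shift r f"
  have ent_g: "entire_fps g" unfolding g_def by (intro entire_fps_shift ent)
  have "f = fps_X ^ r * g"
  proof (rule fps_ext)
    fix k show "fps_nth f k = fps_nth (fps_X ^ r * g) k"
      using z[of k] nth[of k] by (auto simp: g_def fps_X_power_mult_nth)
  qed
  hence fg: "eval_fps f w = w ^ r * eval_fps g w" for w
    using ent_g by (simp add: eval_fps_mult entire_fps_def)
  show ?thesis
  proof (rule that[of "\<lambda>z. eval_fps g (z - t)"])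
    show "(\<lambda>z. eval_fps g (z - t)) holomorphic_on UNIV"
    proof -
      have "(\<lambda>z. z - t) holomorphic_on UNIV" by (intro holomorphic_intros)
      from holomorphic_on_compose[OF this holomorphic_eval_entire[OF ent_g]] show ?thesis
        by (simp add: o_def)
    qed
    show "(\<Sum>s\<in>S. c s * exp (l s * z)) = (z - t) ^ r * eval_fps g (z - t)" for z
      using fg[of "z - t"] ev[of "z - t"] by simp
    show "eval_fps g (t - t) = (\<Sum>s\<in>S. c s * exp (l s * t) * l s ^ r) / fact r"
      using nth[of r] by (simp add: eval_fps_at_0 g_def)
  qed
qed

text \<open>By linearity the powers may be replaced by any polynomial; one whose roots are exactly
  the other nodes isolates \<open>c s\<close>.\<close>

lemma power_sums_zero_imp_zero:
  fixes c l :: "'s \<Rightarrow> complex"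
  assumes fin: "finite S" and inj: "inj_on l S" and z: "\<And>k. (\<Sum>s\<in>S. c s * l s ^ k) = 0" and s: "s \<in> S"
  shows "c s = 0"
proof -
  define p where "p = (\<Prod>u\<in>S - {s}. [:- l u, 1:])"
  have pl: "poly p x = (\<Prod>u\<in>S - {s}. x - l u)" for x by (simp add: p_def poly_prod)
  have "(\<Sum>u\<in>S. c u * poly p (l u)) = (\<Sum>k\<le>degree p. coeff p k * (\<Sum>u\<in>S. c u * l u ^ k))"
    unfolding poly_altdef sum_distrib_left by (subst sum.swap) (simp add: mult_ac)
  also have "\<dots> = 0" by (simp add: z)
  also have "(\<Sum>u\<in>S. c u * poly p (l u)) = c s * poly p (l s) + (\<Sum>u\<in>S - {s}. c u * poly p (l u))"
    using fin s by (simp add: sum.remove)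
  also have "(\<Sum>u\<in>S - {s}. c u * poly p (l u)) = 0"
    using fin by (intro sum.neutral) (auto simp: pl)
  finally have "c s * poly p (l s) = 0" by simp
  moreover have "poly p (l s) \<noteq> 0"
    using fin inj s by (auto simp: pl dest: inj_onD)
  ultimately show ?thesis by simp
qed

text \<open>A Schwarz lemma for several nodes: \<open>F / Q\<close> extends to an entire function,
  the maximum principle transfers its bound from the circle of radius \<open>R\<close> to the node
  \<open>t0\<close>, and the factors of the other nodes are multiplied back.\<close>

lemma norm_at_multiple_zero_le:
  fixes F :: "complex \<Rightarrow> complex" and h :: "nat \<Rightarrow> complex \<Rightarrow> complex"
  assumes h: "\<And>t. t < m \<Longrightarrow> h t holomorphic_on UNIV"
    and Fh: "\<And>t z. t < m \<Longrightarrow> F z = (z - of_nat t) ^ r * h t z"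
    and B: "\<And>z. norm z = R \<Longrightarrow> norm (F z) \<le> B" and R: "R > real m" and t0: "t0 < m"
  shows "norm (h t0 (of_nat t0)) \<le> B / (R - real m) ^ (m * r) * real m ^ (m * r)"
proof -
  define P where "P = (of_nat ` {..<m} :: complex set)"
  define Q where "Q = (\<lambda>z. \<Prod>t<m. (z - of_nat t :: complex) ^ r)"
  define Qt where "Qt = (\<lambda>t z. \<Prod>u\<in>{..<m} - {t}. (z - of_nat u :: complex) ^ r)"
  \<comment> \<open>At a node, \<open>F z / Q z\<close> can be \<open>0 / 0\<close>; the cofactor
    \<open>h t\<close> supplies the value of the entire quotient. Since \<open>z = of_nat t\<close>
    there, \<open>nat \<lfloor>Re z\<rfloor>\<close> recovers \<open>t\<close>.\<close>
  define G where "G = (\<lambda>z. if z \<in> P then (let t = nat \<lfloor>Re z\<rfloor> in h t z / Qt t z) else F z / Q z)"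
  have Q_split: "Q z = (z - of_nat t) ^ r * Qt t z" if "t < m" for t z
    unfolding Q_def Qt_def using that by (subst prod.remove[of _ t]) auto
  \<comment> \<open>\<open>W t\<close> contains no node except \<open>t\<close>. These open sets
    cover the plane, and on each of them \<open>G\<close> is a quotient with non-vanishing
    denominator.\<close>
  define W where "W = (\<lambda>t. UNIV - (of_nat ` ({..<m} - {t}) :: complex set))"
  have W_open: "open (W t)" for t
    unfolding W_def by (intro open_Diff finite_imp_closed) auto
  have Qt_nz: "Qt t z \<noteq> 0" if "z \<in> W t" for t z
    using that by (auto simp: Qt_def W_def)
  have G_eq: "G z = h t z / Qt t z" if "t < m" "z \<in> W t" for t z
  proof (cases "z \<in> P")
    case True
    hence "z = of_nat t" using that by (auto simp: P_def W_def)
    thus ?thesis using True by (simp add: G_def)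
  next
    case False
    hence "z \<noteq> of_nat t" using that by (auto simp: P_def)
    thus ?thesis using False that by (simp add: G_def Fh[of t] Q_split[of t])
  qed
  have "G holomorphic_on (\<Union>t\<in>{..<m}. W t)"
  proof (rule holomorphic_on_UN_open)
    fix t assume t: "t \<in> {..<m}"
    have "(\<lambda>z. h t z / Qt t z) holomorphic_on W t"
      using holomorphic_on_subset[OF h] t Qt_nz[of _ t]
      by (intro holomorphic_intros) (auto simp: Qt_def intro!: holomorphic_intros)
    thus "G holomorphic_on W t"
      using t by (intro holomorphic_transform[OF _ G_eq[symmetric]]) auto
  qed (use W_open in auto)
  also have "(\<Union>t\<in>{..<m}. W t) = UNIV"
  proof -
    have "z \<in> (\<Union>t\<in>{..<m}. W t)" for z
    proof (cases "z \<in> P")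
      case True
      then obtain t where "t < m" "z = of_nat t" by (auto simp: P_def)
      thus ?thesis by (auto simp: W_def)
    next
      case False
      thus ?thesis using t0 by (auto simp: W_def P_def)
    qed
    thus ?thesis by blast
  qed
  finally have holG: "G holomorphic_on UNIV" .
  have Rpos: "R > 0" using R by simp
  have G_bound: "norm (G z) \<le> B / (R - real m) ^ (m * r)" if z: "norm z = R" for z
  proof -
    have "norm (of_nat t :: complex) < R" if "t < m" for t using that R by simp
    hence "z \<notin> P" using z unfolding P_def by blast
    have "(R - real m) ^ (m * r) = (\<Prod>t<m. (R - real m) ^ r)"
      by (simp add: mult.commute flip: power_mult)
    also have "\<dots> \<le> (\<Prod>t<m. norm ((z - of_nat t) ^ r))"
    proof (rule prod_mono, intro conjI)
      fix t assume "t \<in> {..<m}"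
      hence "R - real m \<le> norm (z - of_nat t)"
        using norm_triangle_ineq2[of z "of_nat t"] z by simp
      thus "(R - real m) ^ r \<le> norm ((z - of_nat t) ^ r)"
        unfolding norm_power using R by (intro power_mono) auto
    qed (use R in auto)
    also have "\<dots> = norm (Q z)" by (simp add: Q_def prod_norm)
    finally have Q: "(R - real m) ^ (m * r) \<le> norm (Q z)" .
    have "norm (G z) = norm (F z) / norm (Q z)" using \<open>z \<notin> P\<close> by (simp add: G_def norm_divide)
    also have "\<dots> \<le> B / (R - real m) ^ (m * r)"
      using B[OF z] Q R norm_ge_zero[of "F z"] by (intro frac_le) (auto simp del: norm_ge_zero)
    finally show ?thesis .
  qed
  have G_t0: "norm (G (of_nat t0)) \<le> B / (R - real m) ^ (m * r)"
  proof (rule maximum_modulus_frontier[of G "cball 0 R"])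
    show "G holomorphic_on interior (cball 0 R)" using holG by (rule holomorphic_on_subset) auto
    show "continuous_on (closure (cball 0 R)) G"
      by (rule holomorphic_on_imp_continuous_on[OF holomorphic_on_subset[OF holG]]) auto
    fix z assume "z \<in> frontier (cball (0::complex) R)"
    hence "norm z = R" by (simp add: frontier_cball)
    thus "norm (G z) \<le> B / (R - real m) ^ (m * r)" by (rule G_bound)
  qed (use R t0 in auto)
  have "norm (Qt t0 (of_nat t0)) \<le> real m ^ (m * r)"
  proof -
    have "norm (Qt t0 (of_nat t0)) = (\<Prod>u\<in>{..<m} - {t0}. norm (of_nat t0 - of_nat u :: complex) ^ r)"
      by (simp add: Qt_def norm_power flip: prod_norm)
    also have "\<dots> \<le> (\<Prod>u\<in>{..<m} - {t0}. real m ^ r)"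
    proof (rule prod_mono, intro conjI power_mono)
      fix u assume "u \<in> {..<m} - {t0}"
      have "norm (of_nat t0 - of_nat u :: complex) = \<bar>real t0 - real u\<bar>"
        by (metis norm_of_real of_real_diff of_real_of_nat_eq real_norm_def)
      also have "\<dots> \<le> real m" using t0 \<open>u \<in> _\<close> by auto
      finally show "norm (of_nat t0 - of_nat u :: complex) \<le> real m" .
    qed auto
    also have "\<dots> = real m ^ (r * (m - 1))" using t0 by (simp add: power_mult)
    also have "\<dots> \<le> real m ^ (m * r)" using t0 by (intro power_increasing) (auto simp: mult.commute)
    finally show ?thesis .
  qed
  moreover have W0: "of_nat t0 \<in> W t0" by (auto simp: W_def)
  hence "h t0 (of_nat t0) = G (of_nat t0) * Qt t0 (of_nat t0)"
    using G_eq[OF t0] Qt_nz by simp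
  hence "norm (h t0 (of_nat t0)) = norm (G (of_nat t0)) * norm (Qt t0 (of_nat t0))" by (simp add: norm_mult)
  ultimately show ?thesis
    using G_t0 by (simp only:) (intro mult_mono order_trans[OF norm_ge_zero G_t0], auto)
qed

section \<open>The Gelfond-Schneider theorem\<close>

text \<open>
  \<open>D\<close> is the number of generators of the module that carries the algebraic integers, \<open>m\<close> the number of
  interpolation points, \<open>q\<^sup>2\<close> the number of exponentials, \<open>n\<close> the prescribed and \<open>r\<close> the actual order of
  vanishing. The arithmetic lower bound costs \<open>(const * q\<^sup>2) ^ (D * r)\<close>, the analytic upper bound is
  \<open>(const * r * q * (q / r) ^ m) ^ r\<close>; as \<open>q\<^sup>2 \<le> \<kappa> * r\<close>, the value \<open>m = 2 * D + 5\<close> leaves \<open>1 \<le> (const / r) ^ r\<close>.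
\<close>

lemma gelfond_inequality:
  fixes c x :: real and q n r m D \<kappa> :: nat
  assumes c: "c \<ge> 1" and x: "x > 0" and q: "1 \<le> q" "q \<le> n" and nr: "n \<le> r" and q2: "q ^ 2 = \<kappa> * n"
    and m: "m = 2 * D + 5"
    and ineq: "1 \<le> (real q ^ 4 * (2 * q * c) ^ n * c ^ (2 * q * m) * (2 * q * c) ^ r * c ^ (2 * q * m)) ^ D *
       (c ^ (2 * q * m) * fact r / x ^ r * (real q ^ 4 * (2 * q * c) ^ n * c ^ (2 * q * m) *
          exp (4 * m * r * c * x) * (q / r) ^ (m * r)))"
  shows "real r \<le> (64 * c ^ 2 * c ^ (4 * m)) ^ D * (32 * c ^ (4 * m) * c * exp (4 * m * c * x) / x) * real \<kappa> ^ (2 * D + 3)"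
proof -
  have r: "r \<ge> 1" using q nr by simp
  \<comment> \<open>Chosen so that the arithmetic bound becomes \<open>(K1 * q\<^sup>2) ^ r\<close>
    and the analytic bound \<open>(K2 * (r * q * (q / r) ^ m)) ^ r\<close>, with constants that
    involve none of \<open>q\<close>, \<open>n\<close>, \<open>r\<close>.\<close>
  define K1 where "K1 = 64 * c ^ 2 * c ^ (4 * m)"
  define K2 where "K2 = 32 * c ^ (4 * m) * c * exp (4 * m * c * x) / x"
  have K: "K1 > 0" "K2 > 0" using c x by (auto simp: K1_def K2_def)
  have q4: "real q ^ 4 \<le> 16 ^ r"
  proof -
    have "q \<le> 2 ^ r" using q nr less_exp[of q] by (meson dual_order.trans less_imp_le less_exp)
    hence "real q \<le> 2 ^ r" by (metis of_nat_le_iff of_nat_numeral of_nat_power)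
    hence "real q ^ 4 \<le> (2 ^ r) ^ 4" by (intro power_mono) auto
    also have "\<dots> = (2 ^ 4) ^ r" by (simp only: power_mult[symmetric] mult.commute)
    finally show ?thesis by simp
  qed
  have base: "2 * q * c \<ge> 1"
  proof -
    have "1 * 1 \<le> (2 * real q) * c" using c q by (intro mult_mono) auto
    thus ?thesis by simp
  qed
  have pn: "(2 * q * c) ^ n \<le> (2 * q * c) ^ r" using base nr by (intro power_increasing)
  have cq: "c ^ (2 * q * m) \<le> c ^ (2 * m * r)" using c q nr by (intro power_increasing) auto
  have c0: "c > 0" using c by simp
  have H: "real q ^ 4 * (2 * q * c) ^ n * c ^ (2 * q * m) * (2 * q * c) ^ r * c ^ (2 * q * m) \<le> (K1 * real q ^ 2) ^ r"
  proof -
    have "real q ^ 4 * (2 * q * c) ^ n * c ^ (2 * q * m) * (2 * q * c) ^ r * c ^ (2 * q * m) \<le>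
       16 ^ r * (2 * q * c) ^ r * c ^ (2 * m * r) * (2 * q * c) ^ r * c ^ (2 * m * r)"
      using c0 base by (intro mult_mono q4 pn cq order_refl) (auto intro!: mult_nonneg_nonneg)
    also have "\<dots> = (K1 * real q ^ 2) ^ r"
    proof -
      have "2 * m * r + 2 * m * r = 4 * m * r" by simp
      hence "c ^ (2 * m * r) * c ^ (2 * m * r) = (c ^ (4 * m)) ^ r" by (metis power_add power_mult)
      moreover have "16 ^ r * ((2 * q * c) ^ r * (2 * q * c) ^ r) = (64 * c ^ 2 * real q ^ 2) ^ r"
        by (simp add: power_mult_distrib[symmetric] power2_eq_square mult_ac)
      ultimately have "16 ^ r * ((2 * q * c) ^ r * (2 * q * c) ^ r) * (c ^ (2 * m * r) * c ^ (2 * m * r)) =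
         (64 * c ^ 2 * real q ^ 2) ^ r * (c ^ (4 * m)) ^ r" by (simp only:)
      thus ?thesis by (simp add: K1_def power_mult_distrib mult_ac)
    qed
    finally show ?thesis .
  qed
  have W: "c ^ (2 * q * m) * fact r / x ^ r * (real q ^ 4 * (2 * q * c) ^ n * c ^ (2 * q * m) *
          exp (4 * m * r * c * x) * (q / r) ^ (m * r)) \<le> (K2 * (r * q * (q / r) ^ m)) ^ r"
  proof -
    have "fact r \<le> real r ^ r" using fact_le_power[of r, where 'a = real] by simp
    hence "c ^ (2 * q * m) * fact r / x ^ r * (real q ^ 4 * (2 * q * c) ^ n * c ^ (2 * q * m) *
          exp (4 * m * r * c * x) * (q / r) ^ (m * r)) \<le>
        c ^ (2 * m * r) * real r ^ r / x ^ r * (16 ^ r * (2 * q * c) ^ r * c ^ (2 * m * r) *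
          exp (4 * m * r * c * x) * (q / r) ^ (m * r))"
      using c0 base x
      by (intro mult_mono divide_right_mono q4 pn cq order_refl) (auto intro!: mult_nonneg_nonneg divide_nonneg_nonneg)
    also have "\<dots> = (K2 * (r * q * (q / r) ^ m)) ^ r"
    proof -
      have "2 * m * r + 2 * m * r = 4 * m * r" by simp
      hence 1: "c ^ (2 * m * r) * c ^ (2 * m * r) = (c ^ (4 * m)) ^ r" by (metis power_add power_mult)
      have 2: "exp (4 * m * r * c * x) = exp (4 * m * c * x) ^ r"
        by (simp add: exp_of_nat_mult[symmetric] mult_ac)
      have 3: "(q / r) ^ (m * r) = ((real q / r) ^ m) ^ r" by (simp add: power_mult)
      have 4: "16 ^ r * (2 * q * c) ^ r = (32 * c * q) ^ r"
        by (simp add: power_mult_distrib[symmetric] mult_ac)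
      have "c ^ (2 * m * r) * real r ^ r / x ^ r * (16 ^ r * (2 * q * c) ^ r * c ^ (2 * m * r) *
          exp (4 * m * r * c * x) * (q / r) ^ (m * r)) =
        (c ^ (2 * m * r) * c ^ (2 * m * r)) * real r ^ r / x ^ r * (16 ^ r * (2 * q * c) ^ r) *
          exp (4 * m * r * c * x) * (q / r) ^ (m * r)" by (simp add: mult_ac)
      also have "\<dots> = (c ^ (4 * m)) ^ r * real r ^ r / x ^ r * (32 * c * q) ^ r *
          exp (4 * m * c * x) ^ r * ((real q / r) ^ m) ^ r"
        unfolding 1 2 3 4 ..
      also have "\<dots> = (c ^ (4 * m) * r / x * (32 * c * q) * exp (4 * m * c * x) * (real q / r) ^ m) ^ r"
        by (simp only: power_mult_distrib power_divide)
      also have "c ^ (4 * m) * r / x * (32 * c * q) * exp (4 * m * c * x) * (real q / r) ^ m = K2 * (r * q * (q / r) ^ m)"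
        by (simp add: K2_def mult_ac)
      finally show ?thesis .
    qed
    finally show ?thesis .
  qed
  define Z where "Z = (K1 * real q ^ 2) ^ D * (K2 * (r * q * (q / r) ^ m))"
  have Z0: "Z \<ge> 0" using K by (simp add: Z_def)
  have "1 \<le> ((K1 * real q ^ 2) ^ r) ^ D * (K2 * (r * q * (q / r) ^ m)) ^ r"
    using K c0 base x
    by (intro order_trans[OF ineq] mult_mono power_mono H W)
       (auto intro!: mult_nonneg_nonneg divide_nonneg_nonneg zero_le_power)
  also have "\<dots> = Z ^ r"
  proof -
    have "(u ^ r) ^ D * y ^ r = (u ^ D * y) ^ r" for u y :: real
      by (simp add: power_mult_distrib mult.commute flip: power_mult)
    thus ?thesis unfolding Z_def .
  qed
  finally have "1 \<le> Z ^ r" .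
  hence "Z \<ge> 1" using Z0 r power_less_one_iff[of Z r] by linarith
  also have "Z = K1 ^ D * K2 * (real q ^ (4 * D + 6) * r / real r ^ m)"
  proof -
    \<comment> \<open>The total exponent of \<open>q\<close> is even, so \<open>q\<^sup>2\<close>
      can be replaced by \<open>\<kappa> * n\<close>.\<close>
    have eq: "4 * D + 6 = 2 * D + (1 + m)" using m by simp
    have "real q ^ (4 * D + 6) = (real q ^ 2) ^ D * (real q * real q ^ m)"
      unfolding eq power_add power_mult power_one_right ..
    thus ?thesis by (simp add: Z_def power_mult_distrib power_divide)
  qed
  also have "real q ^ (4 * D + 6) = real \<kappa> ^ (2 * D + 3) * real n ^ (2 * D + 3)"
  proof -
    have "real q ^ (4 * D + 6) = (real q ^ 2) ^ (2 * D + 3)" by (simp flip: power_mult)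
    also have "real q ^ 2 = real \<kappa> * real n" using q2 by (metis of_nat_mult of_nat_power)
    finally show ?thesis by (simp add: power_mult_distrib)
  qed
  also have "K1 ^ D * K2 * (real \<kappa> ^ (2 * D + 3) * real n ^ (2 * D + 3) * r / real r ^ m) \<le>
     K1 ^ D * K2 * (real \<kappa> ^ (2 * D + 3) * real r ^ (2 * D + 3) * r / real r ^ m)"
    using K nr by (intro mult_left_mono divide_right_mono mult_right_mono power_mono) auto
  also have "\<dots> = K1 ^ D * K2 * real \<kappa> ^ (2 * D + 3) / r"
  proof -
    \<comment> \<open>\<open>m = 2 * D + 5\<close> exceeds the exponent \<open>2 * D + 4\<close> of
      \<open>r\<close> in the numerator by one; this surplus is what bounds
      \<open>r\<close>.\<close>
    have "real r ^ m = real r ^ (2 * D + 3) * r * r" unfolding m by (simp add: power_add eval_nat_numeral)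
    thus ?thesis using r by (simp add: field_simps)
  qed
  finally have "real r \<le> K1 ^ D * K2 * real \<kappa> ^ (2 * D + 3)" using r by (simp add: field_simps)
  thus ?thesis by (simp only: K1_def K2_def)
qed

text \<open>Gelfond's auxiliary function is a sum of terms
  \<open>\<eta> p * exp (l p * \<xi> * z)\<close> with \<open>l p = i * a + j * b\<close> for
  \<open>p = (i, j)\<close>. Siegel's lemma provides small integers \<open>\<eta> p\<close>, not all
  zero, for which it vanishes to order at least \<open>n\<close> at \<open>0, ..., m - 1\<close>. A
  first non-zero derivative at these points, freed of powers of \<xi> and multiplied by a
  denominator, is an algebraic integer that the maximum principle makes too small for Liouville's
  inequality.\<close>

lemma gelfond_schneider_integral:
  fixes a b \<xi> :: complex and T :: nat
  assumes ab: "algebraic_int a" "algebraic_int b" and \<xi>: "\<xi> \<noteq> 0" and T: "T > 0"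
    and AB: "algebraic_int (of_nat T * exp (a * \<xi>))" "algebraic_int (of_nat T * exp (b * \<xi>))"
    and indep: "\<And>i j :: int. of_int i * a + of_int j * b = 0 \<Longrightarrow> i = 0 \<and> j = 0"
  shows False
proof -
  define A where "A = of_nat T * exp (a * \<xi>)"
  define B where "B = of_nat T * exp (b * \<xi>)"
  have "algebraic_int z" if "z \<in> {a, b, A, B}" for z using that ab AB by (auto simp: A_def B_def)
  then obtain I v where gf: "generating_family I v" and "\<And>z. z \<in> {a, b, A, B} \<Longrightarrow> \<exists>R. house_le I v z R"
    using algebraic_int_common_family[of "{a, b, A, B}"] by blast
  hence "\<forall>z. \<exists>R. z \<in> {a, b, A, B} \<longrightarrow> house_le I v z R" by blast
  then obtain R0 where R0: "\<And>z. z \<in> {a, b, A, B} \<Longrightarrow> house_le I v z (R0 z)" by metis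
  have finI: "finite I" using gf by (simp add: generating_family_def)
  obtain i0 where i0: "i0 \<in> I" "v i0 \<noteq> 0" using gf by (auto simp: generating_family_def)
  define c where "c = R0 a + R0 b + R0 A + R0 B + T"
  have c1: "c \<ge> 1" using T by (simp add: c_def)
  have hc: "house_le I v z c" if "z \<in> {a, b, A, B}" for z
    using that by (intro house_le_mono[OF R0[OF that]]) (auto simp: c_def)
  have hT: "house_le I v (of_nat T) c" by (intro house_le_mono[OF house_le_of_nat[OF finI]]) (simp add: c_def)
  have ac: "norm a \<le> c" "norm b \<le> c" using house_le_norm_le[OF gf] hc by auto
  define D where "D = card I"
  have D: "D \<ge> 1" using i0 finI by (auto simp: D_def Suc_le_eq card_gt_0_iff)
  define m where "m = 2 * D + 5"
  \<comment> \<open>\<open>\<kappa> * n\<close> is twice \<open>n * m * D\<close>, the number of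
    equations; Siegel's lemma thus works with \<open>q\<^sup>2 = \<kappa> * n\<close>
    unknowns.\<close>
  define \<kappa> where "\<kappa> = 2 * D * m"
  have \<kappa>: "\<kappa> \<ge> 1" using D by (simp add: \<kappa>_def m_def)
  \<comment> \<open>\<open>K\<close> is the bound for \<open>r\<close> in
    \<open>gelfond_inequality\<close> and does not depend on \<open>q\<close>, \<open>n\<close> and
    \<open>r\<close>. Taking \<open>s > K\<close> makes it incompatible with
    \<open>r \<ge> n \<ge> s\<close>.\<close>
  define K where "K = (64 * real c ^ 2 * real c ^ (4 * m)) ^ D *
     (32 * real c ^ (4 * m) * real c * exp (4 * m * real c * norm \<xi>) / norm \<xi>) * real \<kappa> ^ (2 * D + 3)"
  define s where "s = nat \<lceil>K\<rceil> + 1"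
  have s: "s \<ge> 1" "real s > K" by (auto simp: s_def) linarith
  define q where "q = \<kappa> * s"
  define n where "n = \<kappa> * s ^ 2"
  have q1: "q \<ge> 1" using \<kappa> s by (simp add: q_def)
  have qn: "q \<le> n" using s by (simp add: q_def n_def power2_eq_square)
  have q2: "q ^ 2 = \<kappa> * n" by (simp add: q_def n_def power2_eq_square)
  have ns: "n \<ge> s"
  proof -
    have "1 * (s * 1) \<le> \<kappa> * (s * s)" using \<kappa> s by (intro mult_mono) auto
    thus ?thesis by (simp add: n_def power2_eq_square)
  qed

  define S where "S = {..<q} \<times> {..<q}"
  have finS: "finite S" by (simp add: S_def)
  have cardS: "card S = q ^ 2" by (simp add: S_def power2_eq_square)
  have S_ne: "S \<noteq> {}" using cardS q1 by auto
  define l where "l = (\<lambda>p::nat \<times> nat. of_nat (fst p) * a + of_nat (snd p) * b)"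
  \<comment> \<open>The last factor completes the power of \<open>T\<close> to
    \<open>T ^ (2 * q * t)\<close> for every \<open>p\<close>, so that it can be taken out of sums
    over \<open>S\<close>. The subtraction is exact because both coordinates of \<open>p\<close> are
    below \<open>q\<close>.\<close>
  define \<theta> where "\<theta> = (\<lambda>k t p. l p ^ k * A ^ (fst p * t) * B ^ (snd p * t) * of_nat T ^ ((2 * q - fst p - snd p) * t))"
  have l_house: "house_le I v (l p) (2 * q * c)" if "p \<in> S" for p
  proof -
    have "house_le I v (l p) (fst p * c + snd p * c)"
      unfolding l_def by (intro house_le_add house_le_mult house_le_of_nat finI hc) auto
    moreover have "fst p * c + snd p * c \<le> q * c + q * c"
      using that by (intro add_mono mult_right_mono) (auto simp: S_def)
    ultimately show ?thesis by (auto intro: house_le_mono)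
  qed
  have l_inj: "inj_on l S"
  proof (rule inj_onI)
    fix p p' assume "l p = l p'"
    hence "of_int (int (fst p) - int (fst p')) * a + of_int (int (snd p) - int (snd p')) * b = 0"
      by (simp add: l_def algebra_simps)
    from indep[OF this] show "p = p'" by (auto simp: prod_eq_iff)
  qed
  have \<theta>_house: "house_le I v (\<theta> k t p) ((2 * q * c) ^ k * c ^ (2 * q * t))" if "p \<in> S" for k t p
  proof -
    have "house_le I v (\<theta> k t p) ((2 * q * c) ^ k * c ^ (fst p * t) * c ^ (snd p * t) * c ^ ((2 * q - fst p - snd p) * t))"
      unfolding \<theta>_def by (intro house_le_mult house_le_power finI l_house that hc hT) auto
    also have "(2 * q * c) ^ k * c ^ (fst p * t) * c ^ (snd p * t) * c ^ ((2 * q - fst p - snd p) * t) =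
      (2 * q * c) ^ k * c ^ ((fst p + snd p + (2 * q - fst p - snd p)) * t)"
      by (simp only: add_mult_distrib power_add mult.assoc)
    also have "fst p + snd p + (2 * q - fst p - snd p) = 2 * q" using that by (auto simp: S_def)
    finally show ?thesis .
  qed
  have \<theta>_eq: "\<theta> k t p = of_nat T ^ (2 * q * t) * (exp (l p * \<xi> * of_nat t) * l p ^ k)" if "p \<in> S" for k t p
  proof -
    have "A ^ (fst p * t) = of_nat T ^ (fst p * t) * exp (of_nat (fst p * t) * (a * \<xi>))"
      by (simp only: A_def power_mult_distrib exp_of_nat_mult)
    moreover have "B ^ (snd p * t) = of_nat T ^ (snd p * t) * exp (of_nat (snd p * t) * (b * \<xi>))"
      by (simp only: B_def power_mult_distrib exp_of_nat_mult)
    ultimately have "\<theta> k t p = l p ^ k *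
        (of_nat T ^ (fst p * t) * of_nat T ^ (snd p * t) * of_nat T ^ ((2 * q - fst p - snd p) * t)) *
        (exp (of_nat (fst p * t) * (a * \<xi>)) * exp (of_nat (snd p * t) * (b * \<xi>)))"
      by (simp add: \<theta>_def mult_ac)
    also have "of_nat T ^ (fst p * t) * of_nat T ^ (snd p * t) * of_nat T ^ ((2 * q - fst p - snd p) * t) =
        (of_nat T ^ ((fst p + snd p + (2 * q - fst p - snd p)) * t) :: complex)"
      by (simp only: add_mult_distrib power_add)
    also have "fst p + snd p + (2 * q - fst p - snd p) = 2 * q" using that by (auto simp: S_def)
    also have "exp (of_nat (fst p * t) * (a * \<xi>)) * exp (of_nat (snd p * t) * (b * \<xi>)) = exp (l p * \<xi> * of_nat t)"
      unfolding exp_add[symmetric] by (simp add: l_def algebra_simps)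
    finally show ?thesis by (simp add: mult_ac)
  qed

  define X where "X = (2 * q * c) ^ n * c ^ (2 * q * m)"
  have X1: "X \<ge> 1" using q1 c1 by (simp add: X_def)
  have "\<forall>k t p. \<exists>M. k < n \<and> t < m \<and> p \<in> S \<longrightarrow>
      (\<forall>i\<in>I. \<theta> k t p * v i = (\<Sum>j\<in>I. of_int (M i j) * v j)) \<and> (\<forall>i\<in>I. (\<Sum>j\<in>I. \<bar>M i j\<bar>) \<le> int X)"
  proof (intro allI)
    fix k t p
    show "\<exists>M. k < n \<and> t < m \<and> p \<in> S \<longrightarrow>
      (\<forall>i\<in>I. \<theta> k t p * v i = (\<Sum>j\<in>I. of_int (M i j) * v j)) \<and> (\<forall>i\<in>I. (\<Sum>j\<in>I. \<bar>M i j\<bar>) \<le> int X)"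
    proof (cases "k < n \<and> t < m \<and> p \<in> S")
      case True
      have "(2 * q * c) ^ k * c ^ (2 * q * t) \<le> X"
        unfolding X_def using True q1 c1 by (intro mult_mono power_increasing) auto
      with \<theta>_house[of p k t] True have "house_le I v (\<theta> k t p) X" by (auto intro: house_le_mono)
      thus ?thesis unfolding house_le_def by blast
    qed blast
  qed
  then obtain M where M: "\<And>k t p i. k < n \<Longrightarrow> t < m \<Longrightarrow> p \<in> S \<Longrightarrow> i \<in> I \<Longrightarrow>
      \<theta> k t p * v i = (\<Sum>j\<in>I. of_int (M k t p i j) * v j) \<and> (\<Sum>j\<in>I. \<bar>M k t p i j\<bar>) \<le> int X" by metis
  define E where "E = {..<n} \<times> {..<m} \<times> I"
  have finE: "finite E" using finI by (simp add: E_def)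
  have cardE: "2 * card E \<le> card S"
    unfolding cardS q2 E_def by (simp add: card_cartesian_product \<kappa>_def D_def)
  \<comment> \<open>To annihilate \<open>w k t\<close> it is enough to annihilate all coefficients
    of the \<open>v j\<close> in \<open>w k t * v i0\<close>. Hence only row \<open>i0\<close> of
    each matrix enters, and each \<open>(k, t)\<close> gives \<open>card I\<close>
    equations.\<close>
  define N where "N = (\<lambda>e p. case e of (k, t, j) \<Rightarrow> M k t p i0 j)"
  have N_le: "\<bar>N e p\<bar> \<le> int X" if "e \<in> E" "p \<in> S" for e p
  proof -
    obtain k t j where ktj: "e = (k, t, j)" by (cases e)
    with that have e: "e = (k, t, j)" "k < n" "t < m" "j \<in> I" by (auto simp: E_def)
    have "\<bar>M k t p i0 j\<bar> \<le> (\<Sum>j\<in>I. \<bar>M k t p i0 j\<bar>)"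
      using member_le_sum[of j I "\<lambda>j. \<bar>M k t p i0 j\<bar>"] e finI by simp
    thus ?thesis using M[OF e(2,3) that(2) i0(1)] e by (simp add: N_def)
  qed
  obtain \<eta> where \<eta>: "\<exists>p\<in>S. \<eta> p \<noteq> 0" "\<And>p. p \<in> S \<Longrightarrow> \<bar>\<eta> p\<bar> \<le> int (card S * X)"
    "\<And>e. e \<in> E \<Longrightarrow> (\<Sum>p\<in>S. N e p * \<eta> p) = 0"
    using siegel_lemma[of E S X N, OF finE finS S_ne cardE X1 N_le] by auto
  define w where "w = (\<lambda>k t. \<Sum>p\<in>S. of_int (\<eta> p) * \<theta> k t p)"
  have w_zero: "w k t = 0" if "k < n" "t < m" for k t
  proof -
    have "w k t * v i0 = (\<Sum>p\<in>S. of_int (\<eta> p) * (\<Sum>j\<in>I. of_int (M k t p i0 j) * v j))"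
      unfolding w_def sum_distrib_right
      by (intro sum.cong refl) (metis M[OF that _ i0(1)] mult.assoc)
    also have "\<dots> = (\<Sum>j\<in>I. of_int (\<Sum>p\<in>S. M k t p i0 j * \<eta> p) * v j)"
      unfolding sum_distrib_left of_int_sum sum_distrib_right by (subst sum.swap) (simp add: mult_ac)
    also have "\<dots> = 0"
    proof (intro sum.neutral ballI)
      fix j assume "j \<in> I"
      hence "(k, t, j) \<in> E" using that by (simp add: E_def)
      from \<eta>(3)[OF this] show "of_int (\<Sum>p\<in>S. M k t p i0 j * \<eta> p) * v j = 0" by (simp only: N_def prod.case of_int_0 mult_zero_left)
    qed
    finally show ?thesis using i0 by simp
  qed
  \<comment> \<open>Otherwise all derivatives at 0 vanish. The exponents \<open>l p\<close> are
    distinct by the independence of \<open>a\<close> and \<open>b\<close>, so \<open>\<eta>\<close>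
    would vanish on \<open>S\<close>.\<close>
  have ex_w: "\<exists>k. \<exists>t<m. w k t \<noteq> 0"
  proof (rule ccontr)
    assume "\<not> (\<exists>k. \<exists>t<m. w k t \<noteq> 0)"
    hence "w k 0 = 0" for k using D by (auto simp: m_def)
    hence "(\<Sum>p\<in>S. of_int (\<eta> p) * l p ^ k) = 0" for k by (simp add: w_def \<theta>_def)
    from power_sums_zero_imp_zero[OF finS l_inj this] \<eta>(1) show False by auto
  qed
  \<comment> \<open>Minimal over all nodes together: the maximum principle needs zeros of order at
    least \<open>r\<close> at every node, Liouville's inequality a single node where order
    \<open>r\<close> gives a non-zero value.\<close>
  define r where "r = (LEAST k. \<exists>t<m. w k t \<noteq> 0)"
  have "\<exists>t<m. w r t \<noteq> 0" unfolding r_def using ex_w by (rule LeastI_ex)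
  then obtain t0 where t0: "t0 < m" "w r t0 \<noteq> 0" by blast
  have w_below: "w k t = 0" if "k < r" "t < m" for k t
    using that not_less_Least[of k "\<lambda>k. \<exists>t<m. w k t \<noteq> 0"] by (auto simp: r_def)
  have nr: "n \<le> r" using w_zero t0 by (meson not_le)
  have r1: "r \<ge> 1" using nr qn q1 by simp

  define F where "F = (\<lambda>z. \<Sum>p\<in>S. of_int (\<eta> p) * exp (l p * \<xi> * z))"
  \<comment> \<open>Each derivative contributes a factor \<xi>, which may be transcendental; here it
    is separated from the algebraic integer \<open>w k t\<close>.\<close>
  have coeff_w: "(\<Sum>p\<in>S. of_int (\<eta> p) * exp (l p * \<xi> * of_nat t) * (l p * \<xi>) ^ k) = \<xi> ^ k / of_nat T ^ (2 * q * t) * w k t" for k t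
  proof -
    have "w k t = of_nat T ^ (2 * q * t) * (\<Sum>p\<in>S. of_int (\<eta> p) * (exp (l p * \<xi> * of_nat t) * l p ^ k))"
      unfolding w_def sum_distrib_left by (intro sum.cong refl) (simp add: \<theta>_eq mult_ac)
    moreover have "(\<Sum>p\<in>S. of_int (\<eta> p) * exp (l p * \<xi> * of_nat t) * (l p * \<xi>) ^ k) =
        \<xi> ^ k * (\<Sum>p\<in>S. of_int (\<eta> p) * (exp (l p * \<xi> * of_nat t) * l p ^ k))"
      by (simp add: sum_distrib_left power_mult_distrib mult_ac)
    ultimately show ?thesis using T by simp
  qed
  have "\<forall>t. \<exists>h. t < m \<longrightarrow> h holomorphic_on UNIV \<and> (\<forall>z. F z = (z - of_nat t) ^ r * h z) \<and>
      h (of_nat t) = \<xi> ^ r / of_nat T ^ (2 * q * t) * w r t / fact r"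
  proof
    fix t
    show "\<exists>h. t < m \<longrightarrow> h holomorphic_on UNIV \<and> (\<forall>z. F z = (z - of_nat t) ^ r * h z) \<and>
      h (of_nat t) = \<xi> ^ r / of_nat T ^ (2 * q * t) * w r t / fact r"
    proof (cases "t < m")
      case True
      have "(\<Sum>p\<in>S. of_int (\<eta> p) * exp (l p * \<xi> * of_nat t) * (l p * \<xi>) ^ k) = 0" if "k < r" for k
        unfolding coeff_w using w_below[OF that True] by simp
      from exp_sum_factor_zero[OF finS this] obtain h where "h holomorphic_on UNIV"
        "\<And>z. (\<Sum>p\<in>S. of_int (\<eta> p) * exp (l p * \<xi> * z)) = (z - of_nat t) ^ r * h z"
        "h (of_nat t) = (\<Sum>p\<in>S. of_int (\<eta> p) * exp (l p * \<xi> * of_nat t) * (l p * \<xi>) ^ r) / fact r"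
        by blast
      thus ?thesis unfolding coeff_w F_def by blast
    qed blast
  qed
  then obtain h where h: "\<And>t. t < m \<Longrightarrow> h t holomorphic_on UNIV"
    "\<And>t z. t < m \<Longrightarrow> F z = (z - of_nat t) ^ r * h t z"
    "\<And>t. t < m \<Longrightarrow> h t (of_nat t) = \<xi> ^ r / of_nat T ^ (2 * q * t) * w r t / fact r" by metis

  \<comment> \<open>Then \<open>m / (R - m) = q / r\<close>, while \<open>q * R\<close> is at most a
    constant times \<open>r\<close>, so the growth of the exponentials costs only a constant to the
    power \<open>r\<close>.\<close>
  define R where "R = real m + real m * real r / real q"
  define B0 where "B0 = real q ^ 4 * real X * exp (2 * q * c * norm \<xi> * R)"
  have m1: "m > 0" by (simp add: m_def)
  have R: "R > real m" using m1 r1 q1 by (simp add: R_def)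
  have B0: "norm (F z) \<le> B0" if z: "norm z = R" for z
  proof -
    have "norm (F z) \<le> (\<Sum>p\<in>S. real (card S * X) * exp (2 * q * c * norm \<xi> * R))"
      unfolding F_def
    proof (rule sum_norm_le)
      fix p assume p: "p \<in> S"
      have "norm (complex_of_int (\<eta> p)) = real_of_int \<bar>\<eta> p\<bar>" by simp
      also have "\<dots> \<le> real_of_int (int (card S * X))" using \<eta>(2)[OF p] by (simp only: of_int_le_iff)
      finally have 1: "norm (complex_of_int (\<eta> p)) \<le> real (card S * X)" by simp
      have "norm (exp (l p * \<xi> * z)) \<le> exp (norm (l p * \<xi> * z))" by (rule norm_exp)
      also have "norm (l p * \<xi> * z) \<le> 2 * q * c * norm \<xi> * R"
        unfolding norm_mult z using house_le_norm_le[OF gf l_house[OF p]] R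
        by (intro mult_right_mono) auto
      finally have 2: "norm (exp (l p * \<xi> * z)) \<le> exp (2 * q * c * norm \<xi> * R)" by simp
      show "norm (of_int (\<eta> p) * exp (l p * \<xi> * z)) \<le> real (card S * X) * exp (2 * q * c * norm \<xi> * R)"
        unfolding norm_mult by (intro mult_mono 1 2) auto
    qed
    also have "\<dots> = B0" by (simp add: B0_def cardS eval_nat_numeral)
    finally show ?thesis .
  qed
  have ht0: "norm (h t0 (of_nat t0)) \<le> B0 / (R - real m) ^ (m * r) * real m ^ (m * r)"
    by (rule norm_at_multiple_zero_le[where F = F and h = h and m = m and r = r, OF h(1,2) B0 R t0(1)])

  have w_le: "norm (w r t0) \<le> real c ^ (2 * q * m) * fact r / norm \<xi> ^ r * (real q ^ 4 * (2 * q * real c) ^ n * real c ^ (2 * q * m) *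
          exp (4 * m * r * real c * norm \<xi>) * (q / r) ^ (m * r))"
  proof -
    have "w r t0 = of_nat T ^ (2 * q * t0) * fact r / \<xi> ^ r * h t0 (of_nat t0)"
      using h(3)[OF t0(1)] \<xi> T by (simp add: field_simps)
    hence "norm (w r t0) = real T ^ (2 * q * t0) * fact r / norm \<xi> ^ r * norm (h t0 (of_nat t0))"
      by (simp add: norm_mult norm_divide norm_power)
    also have "\<dots> \<le> real c ^ (2 * q * m) * fact r / norm \<xi> ^ r * (real q ^ 4 * (2 * q * real c) ^ n * real c ^ (2 * q * m) *
          exp (4 * m * r * real c * norm \<xi>) * (q / r) ^ (m * r))"
    proof (intro mult_mono divide_right_mono)
      have "real T ^ (2 * q * t0) \<le> real c ^ (2 * q * t0)" by (intro power_mono) (auto simp: c_def)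
      also have "\<dots> \<le> real c ^ (2 * q * m)" using c1 t0 by (intro power_increasing) auto
      finally show "real T ^ (2 * q * t0) \<le> real c ^ (2 * q * m)" .
      have "real q * R = real q * real m + real m * real r"
        using q1 by (simp add: R_def distrib_left)
      hence "2 * real q * R = 2 * (real q * real m) + 2 * (real m * real r)" by linarith
      also have "real q * real m \<le> real m * real r"
        using qn nr by (simp add: mult.commute mult_left_mono)
      finally have "2 * real q * R \<le> 4 * (real m * real r)" by simp
      hence "(2 * real q * R) * (c * norm \<xi>) \<le> (4 * (real m * real r)) * (c * norm \<xi>)"
        by (intro mult_right_mono) auto
      hence e: "exp (2 * q * c * norm \<xi> * R) \<le> exp (4 * m * r * real c * norm \<xi>)"
        by (simp add: mult_ac)
      have Rm: "R - real m = real m * (real r / real q)" by (simp add: R_def)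
      have "norm (h t0 (of_nat t0)) \<le> B0 / (R - real m) ^ (m * r) * real m ^ (m * r)" by (rule ht0)
      also have "\<dots> = B0 * (q / r) ^ (m * r)"
        unfolding Rm power_mult_distrib using m1 q1 r1 by (simp add: power_divide field_simps)
      also have "\<dots> \<le> real q ^ 4 * real X * exp (4 * m * r * real c * norm \<xi>) * (q / r) ^ (m * r)"
        unfolding B0_def using e by (intro mult_right_mono mult_left_mono) auto
      finally show "norm (h t0 (of_nat t0)) \<le> real q ^ 4 * (2 * q * real c) ^ n * real c ^ (2 * q * m) *
          exp (4 * m * r * real c * norm \<xi>) * (q / r) ^ (m * r)" by (simp add: X_def mult_ac)
    qed auto
    finally show ?thesis .
  qed

  \<comment> \<open>\<open>q ^ 4\<close> is \<open>card S\<close> taken twice: once as the number of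
    terms and once from Siegel's bound for \<open>\<eta>\<close>.\<close>
  define H where "H = q ^ 4 * (2 * q * c) ^ n * c ^ (2 * q * m) * (2 * q * c) ^ r * c ^ (2 * q * m)"
  have w_house: "house_le I v (w r t0) H"
  proof -
    have "house_le I v (w r t0) (\<Sum>p\<in>S. (card S * X) * ((2 * q * c) ^ r * c ^ (2 * q * m)))"
      unfolding w_def
    proof (intro house_le_sum finI finS house_le_mult)
      fix p assume p: "p \<in> S"
      show "house_le I v (of_int (\<eta> p)) (card S * X)"
        using \<eta>(2)[OF p] by (intro house_le_mono[OF house_le_of_int[OF finI]]) linarith
      show "house_le I v (\<theta> r t0 p) ((2 * q * c) ^ r * c ^ (2 * q * m))"
        using t0 c1 by (intro house_le_mono[OF \<theta>_house[OF p]] mult_left_mono power_increasing) auto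
    qed
    also have "(\<Sum>p\<in>S. (card S * X) * ((2 * q * c) ^ r * c ^ (2 * q * m))) = H"
      by (simp add: H_def X_def cardS mult_ac eval_nat_numeral)
    finally show ?thesis .
  qed
  have "1 \<le> norm (w r t0) * real H ^ D"
    unfolding D_def by (rule house_le_lower_bound[OF gf w_house t0(2)])
  also have "\<dots> \<le> (real c ^ (2 * q * m) * fact r / norm \<xi> ^ r * (real q ^ 4 * (2 * q * real c) ^ n * real c ^ (2 * q * m) *
          exp (4 * m * r * real c * norm \<xi>) * (q / r) ^ (m * r))) * real H ^ D"
    using w_le by (intro mult_right_mono) auto
  finally have "real r \<le> K"
    unfolding K_def
    by (intro gelfond_inequality[of "real c" "norm \<xi>" q n r \<kappa> m D])
       (use c1 \<xi> q1 qn nr q2 in \<open>auto simp: m_def H_def mult.commute\<close>)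
  thus False using s(2) ns nr by linarith
qed

text \<open>In classical notation the base is \<open>exp (a * \<xi>)\<close> and the exponent is the
  irrational number \<open>b / a\<close>. Passing to \<open>T * a\<close>, \<open>T * b\<close>,
  \<open>\<xi> / T\<close> leaves both exponentials unchanged and makes the coefficients
  integral.\<close>

theorem gelfond_schneider:
  fixes a b \<xi> :: complex
  assumes ab: "algebraic a" "algebraic b" and \<xi>: "\<xi> \<noteq> 0"
    and AB: "algebraic (exp (a * \<xi>))" "algebraic (exp (b * \<xi>))"
    and indep: "\<And>i j :: int. of_int i * a + of_int j * b = 0 \<Longrightarrow> i = 0 \<and> j = 0"
  shows False
proof -
  have "algebraic z" if "z \<in> {a, b, exp (a * \<xi>), exp (b * \<xi>)}" for z using that ab AB by auto
  then obtain T :: nat where T: "T > 0" "\<And>z. z \<in> {a, b, exp (a * \<xi>), exp (b * \<xi>)} \<Longrightarrow> algebraic_int (of_nat T * z)"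
    using algebraic_common_denominator[of "{a, b, exp (a * \<xi>), exp (b * \<xi>)}"] by blast
  have eq: "of_nat T * z * (\<xi> / of_nat T) = z * \<xi>" for z :: complex using T(1) by simp
  show False
  proof (rule gelfond_schneider_integral[of "of_nat T * a" "of_nat T * b" "\<xi> / of_nat T" T])
    fix i j :: int
    assume "of_int i * (of_nat T * a) + of_int j * (of_nat T * b) = 0"
    hence "of_nat T * (of_int i * a + of_int j * b) = 0" by (simp add: algebra_simps)
    thus "i = 0 \<and> j = 0" using T(1) indep by simp
  qed (use T \<xi> eq in auto)
qed

section \<open>Simple E-functions\<close>

interpretation of_rat_poly: map_poly_comm_ring_hom "of_rat :: rat \<Rightarrow> complex" ..

text \<open>A rational polynomial of least degree among those vanishing at \<open>a\<close> is
  irreducible. Thus the growth condition, which is imposed on conjugates, also bounds the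
  coefficients themselves.\<close>

lemma galois_conjugate_refl:
  assumes "algebraic a"
  shows "galois_conjugate a a"
proof -
  define Q where "Q = (\<lambda>p :: rat poly. p \<noteq> 0 \<and> poly (map_poly of_rat p) a = 0)"
  obtain p0 :: "int poly" where "p0 \<noteq> 0" "poly (of_int_poly p0) a = 0"
    using algebraicE'[OF assms] by blast
  moreover have "map_poly of_rat (of_int_poly p0 :: rat poly) = (of_int_poly p0 :: complex poly)"
    by (simp add: map_poly_map_poly o_def)
  ultimately have "Q (of_int_poly p0)" by (simp add: Q_def)
  then obtain p where p: "Q p" and least: "\<And>f. Q f \<Longrightarrow> degree p \<le> degree f"
    using ex_has_least_nat[of Q "of_int_poly p0" degree] by blast
  have no_unit: "is_unit g" if "p = f * g" "Q f" for f g
  proof -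
    have "f \<noteq> 0" "g \<noteq> 0" using that p by (auto simp: Q_def)
    hence "degree p = degree f + degree g" using that by (simp add: degree_mult_eq)
    hence "degree g = 0" using least[OF that(2)] by simp
    thus ?thesis using \<open>g \<noteq> 0\<close> by (simp add: is_unit_iff_degree)
  qed
  have "irreducible p"
  proof (rule irreducibleI)
    show "p \<noteq> 0" using p by (simp add: Q_def)
    show "\<not> is_unit p"
    proof
      assume "is_unit p"
      then obtain c where "p = [:c:]" "c \<noteq> 0" by (metis is_unit_poly_iff is_unit_iff_degree degree_eq_zeroE not_is_unit_0 pCons_0_0)
      thus False using p by (simp add: Q_def map_poly_pCons)
    qed
    fix f g assume fg: "p = f * g"
    hence "poly (map_poly of_rat f) a * poly (map_poly of_rat g) a = 0"
      using p by (simp add: Q_def of_rat_poly.hom_mult)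
    moreover have "f \<noteq> 0" "g \<noteq> 0" using fg p by (auto simp: Q_def)
    ultimately have "Q f \<or> Q g" by (auto simp: Q_def)
    thus "is_unit f \<or> is_unit g" using no_unit fg by (metis mult.commute)
  qed
  thus ?thesis using p unfolding galois_conjugate_def Q_def by blast
qed

lemma E_function_imp_entire:
  assumes "E_function f"
  shows "entire_fps f"
proof -
  from assms obtain C where alg: "\<And>n. algebraic (fact n * fps_nth f n)" and C: "C > 0"
    "\<And>n b. galois_conjugate (fact n * fps_nth f n) b \<Longrightarrow> norm b \<le> C ^ (n + 1)"
    unfolding E_function_def Let_def by blast
  have bound: "norm (fps_nth f n) \<le> C * (C ^ n / fact n)" for n
  proof -
    have "norm (fact n * fps_nth f n) \<le> C ^ (n + 1)" by (rule C(2)[OF galois_conjugate_refl[OF alg]])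
    thus ?thesis by (simp add: norm_mult field_simps)
  qed
  have "summable (\<lambda>n. fps_nth f n * z ^ n)" for z
  proof (rule summable_comparison_test')
    have "summable (\<lambda>n. (C * norm z) ^ n /\<^sub>R fact n)" by (rule summable_exp_generic)
    thus "summable (\<lambda>n. C * ((C * norm z) ^ n / fact n))"
      by (intro summable_mult) (simp add: field_simps)
    fix n
    have "norm (fps_nth f n * z ^ n) \<le> C * (C ^ n / fact n) * norm z ^ n"
      unfolding norm_mult norm_power using bound by (intro mult_right_mono) auto
    thus "norm (fps_nth f n * z ^ n) \<le> C * ((C * norm z) ^ n / fact n)"
      by (simp add: power_mult_distrib)
  qed
  thus ?thesis unfolding entire_fps_def fps_conv_radius_def by (rule conv_radius_inftyI'')
qed

text \<open>Otherwise \<open>p\<close> and \<open>q\<close> are coprime over the rationals, and a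
  Bezout relation evaluated at \<open>a\<close> reads \<open>0 = 1\<close>.\<close>

lemma irreducible_dvd_if_common_root:
  fixes p q :: "rat poly" and a :: complex
  assumes p: "irreducible p" "poly (map_poly of_rat p) a = 0" and q: "poly (map_poly of_rat q) a = 0"
  shows "p dvd q"
proof (rule ccontr)
  assume "\<not> p dvd q"
  hence "coprime p q" using p(1) by (simp add: irreducible_imp_prime_elem prime_elem_imp_coprime)
  then obtain u v where "u * p + v * q = 1"
    using bezout_coefficients_fst_snd[of p q] by (auto simp: coprime_iff_gcd_eq_1)
  hence "poly (map_poly of_rat (u * p + v * q)) a = 1" by simp
  thus False using p q by (simp add: of_rat_poly.hom_mult of_rat_poly.hom_add)
qed

text \<open>Both \<open>(D a)\<^sup>n\<close> and its conjugates are roots of one monic integer polynomial whose roots are at most \<open>R\<^sup>n\<close>.\<close>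

lemma galois_conjugate_power_bound:
  assumes "algebraic a"
  obtains R :: nat where "\<And>n b. galois_conjugate (a ^ n) b \<Longrightarrow> norm b \<le> real R ^ n"
proof -
  obtain D :: nat where D: "D > 0" "algebraic_int (of_nat D * a)" using algebraic_denominator[OF assms] .
  then obtain I v where "generating_family I v" "\<exists>R. house_le I v (of_nat D * a) R"
    using algebraic_int_common_family[of "{of_nat D * a}"] by auto
  then obtain R where gf: "generating_family I v" and R: "house_le I v (of_nat D * a) R" by blast
  have "norm b \<le> real R ^ n" if "galois_conjugate (a ^ n) b" for n b
  proof -
    from that obtain p :: "rat poly" where p: "irreducible p" "poly (map_poly of_rat p) (a ^ n) = 0"
      "poly (map_poly of_rat p) b = 0" unfolding galois_conjugate_def by blast
    have "finite I" using gf by (simp add: generating_family_def)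
    from house_le_char_poly[OF gf house_le_power[OF this R, of n]] obtain G :: "int poly"
      where G: "poly (of_int_poly G) ((of_nat D * a) ^ n) = 0"
        "\<And>z :: complex. poly (of_int_poly G) z = 0 \<Longrightarrow> norm z \<le> R ^ n" by metis
    \<comment> \<open>Substituting \<open>D ^ n * x\<close> turns the relation for
      \<open>(D * a) ^ n\<close> into a rational one for \<open>a ^ n\<close>, which the irreducible
      \<open>p\<close> must divide.\<close>
    define Q :: "rat poly" where "Q = of_int_poly G \<circ>\<^sub>p [:0, of_nat (D ^ n):]"
    have lin: "map_poly of_rat [:0, c:] = ([:0, of_rat c:] :: complex poly)" for c
      by (rule poly_eqI) (simp add: coeff_map_poly coeff_pCons split: nat.split)
    have Q: "poly (map_poly of_rat Q) z = poly (of_int_poly G) (of_nat D ^ n * z)" for z :: complex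
      unfolding Q_def of_rat_hom.map_poly_pcompose poly_pcompose lin
      by (simp add: map_poly_map_poly o_def mult.commute of_rat_power)
    have "poly (map_poly of_rat Q) (a ^ n) = 0" using G(1) by (simp add: Q power_mult_distrib)
    hence "p dvd Q" using p by (intro irreducible_dvd_if_common_root)
    then obtain q where "Q = p * q" by (elim dvdE)
    hence "poly (map_poly of_rat Q) b = 0" using p(3) by (simp add: of_rat_poly.hom_mult)
    hence "norm (of_nat D ^ n * b) \<le> R ^ n" unfolding Q by (rule G(2))
    hence "real D ^ n * norm b \<le> real R ^ n" by (simp add: norm_mult norm_power)
    moreover have "1 * norm b \<le> real D ^ n * norm b" using D(1) by (intro mult_right_mono one_le_power) auto
    ultimately show ?thesis by simp
  qed
  thus ?thesis using that by blast
qed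

lemma holonomic_fps_exp:
  assumes "algebraic a"
  shows "holonomic (fps_exp a)"
proof -
  \<comment> \<open>The differential equation is \<open>y' - a y = 0\<close>.\<close>
  define R :: "nat \<Rightarrow> complex fls" where "R = (\<lambda>i. if i = 0 then fps_to_fls (fps_const (- a)) else 1)"
  have const: "algebraic_ratfun (fps_to_fls (fps_const c))" if "algebraic c" for c
    unfolding algebraic_ratfun_def
    by (rule exI[of _ "[:c:]"], rule exI[of _ 1])
       (use that in \<open>auto simp: algebraic_poly_def coeff_pCons fps_of_poly_const split: nat.splits
          intro: rat_imp_algebraic\<close>)
  have "algebraic_ratfun (R i)" for i
    unfolding R_def using const[of "- a"] const[of 1] assms by (auto intro: rat_imp_algebraic)
  moreover have "(\<Sum>i\<le>1. R i * fps_to_fls ((fps_deriv ^^ i) (fps_exp a))) = 0"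
    by (simp add: R_def fls_times_fps_to_fls)
  moreover have "R 1 \<noteq> 0" by (simp add: R_def)
  ultimately show ?thesis unfolding holonomic_def by blast
qed

lemma E_function_fps_exp:
  assumes "algebraic a"
  shows "E_function (fps_exp a)"
proof -
  have coeff: "fact n * fps_nth (fps_exp a) n = a ^ n" for n by simp
  obtain R :: nat where R: "\<And>n b. galois_conjugate (a ^ n) b \<Longrightarrow> norm b \<le> real R ^ n"
    using galois_conjugate_power_bound[OF assms] by blast
  obtain D :: nat where D: "D > 0" "algebraic_int (of_nat D * a)" using algebraic_denominator[OF assms] .
  \<comment> \<open>\<open>R\<close> may be 0, whereas the growth constant has to be positive, and
    the exponent \<open>n + 1\<close> calls for a base of at least 1.\<close>
  have conj: "norm b \<le> real (R + 1) ^ (n + 1)" if "galois_conjugate (a ^ n) b" for n b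
  proof -
    have "norm b \<le> real R ^ n" using R that by blast
    also have "\<dots> \<le> real (R + 1) ^ n" by (intro power_mono) auto
    also have "\<dots> \<le> real (R + 1) ^ (n + 1)" by (intro power_increasing) auto
    finally show ?thesis .
  qed
  have den: "algebraic_int (of_nat (D ^ n) * a ^ m)" if "m \<le> n" for n m
  proof -
    have "algebraic_int (of_nat (D ^ (n - m)) * (of_nat D * a) ^ m)"
      by (intro algebraic_int_of_nat_mult_complex algebraic_int_power_complex D)
    moreover have "D ^ n = D ^ (n - m) * D ^ m" using that by (simp flip: power_add)
    ultimately show ?thesis by (simp add: power_mult_distrib mult.assoc)
  qed
  show ?thesis unfolding E_function_def Let_def coeff
  proof (intro conjI allI)
    show "algebraic (a ^ n)" for n by (rule algebraic_power_complex[OF assms])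
    show "holonomic (fps_exp a)" by (rule holonomic_fps_exp[OF assms])
    show "\<exists>C1>0. \<forall>n b. galois_conjugate (a ^ n) b \<longrightarrow> norm b \<le> C1 ^ (n + 1)"
      using conj by (intro exI[of _ "real (R + 1)"]) auto
    have "real D ^ n \<le> real D ^ (n + 1)" for n using D(1) by (intro power_increasing) auto
    thus "\<exists>(C2::real) d. C2 > 0 \<and> (\<forall>n. d n > 0 \<and> real (d n) \<le> C2 ^ (n + 1) \<and>
            (\<forall>m\<le>n. algebraic_int (of_nat (d n) * a ^ m)))"
      using D(1) den by (intro exI[of _ "real D"] exI[of _ "\<lambda>n. D ^ n"]) auto
  qed
qed

lemma E_unit_fps_exp:
  assumes "algebraic a"
  shows "E_unit (fps_exp a)"
  unfolding E_unit_def
  using E_function_fps_exp[OF assms] E_function_fps_exp[of "- a"] assms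
  by (auto intro!: exI[of _ "fps_exp (- a)"] simp flip: fps_exp_add_mult)

lemma E_unit_one: "E_unit 1"
  using E_unit_fps_exp[of 0] by simp

lemma E_unit_entire: "E_unit u \<Longrightarrow> entire_fps u"
  by (simp add: E_unit_def E_function_imp_entire)

lemma E_unit_eval_nonzero:
  assumes "E_unit u"
  shows "eval_fps u z \<noteq> 0"
proof -
  obtain v where "E_function u" "E_function v" "u * v = 1" using assms by (auto simp: E_unit_def)
  hence "eval_fps u z * eval_fps v z = 1"
    by (metis E_function_imp_entire eval_entire_mult eval_fps_1)
  thus ?thesis by auto
qed

section \<open>Polynomials in an exponential\<close>

interpretation fps_const_hom: comm_ring_hom "fps_const :: complex \<Rightarrow> complex fps"
  by unfold_locales (auto simp: fps_const_add fps_const_mult)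

interpretation fps_const_poly: map_poly_comm_ring_hom "fps_const :: complex \<Rightarrow> complex fps" ..

abbreviation poly_fps :: "complex poly \<Rightarrow> complex fps \<Rightarrow> complex fps" where
  "poly_fps P f \<equiv> poly (map_poly fps_const P) f"

lemma poly_fps_altdef: "poly_fps P f = (\<Sum>i\<le>degree P. fps_const (coeff P i) * f ^ i)"
proof -
  have "degree (map_poly fps_const P) = degree P" by (rule degree_map_poly) auto
  thus ?thesis by (simp add: poly_altdef coeff_map_poly)
qed

lemma poly_fps_mult: "poly_fps (P * Q) f = poly_fps P f * poly_fps Q f"
  by (simp add: fps_const_poly.hom_mult)

lemma poly_fps_power: "poly_fps (P ^ n) f = poly_fps P f ^ n"
  by (induction n) (simp_all add: poly_fps_mult)

lemma poly_fps_exp_entire: "entire_fps (poly_fps P (fps_exp \<beta>))"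
  unfolding poly_fps_altdef by (intro entire_fps_sum entire_fps_mult) (auto simp: fps_exp_power_mult)

lemma eval_poly_fps_exp: "eval_fps (poly_fps P (fps_exp \<beta>)) z = poly P (exp (\<beta> * z))"
proof -
  have "eval_fps (poly_fps P (fps_exp \<beta>)) z = (\<Sum>i\<le>degree P. coeff P i * exp (of_nat i * \<beta> * z))"
    unfolding poly_fps_altdef fps_exp_power_mult
    by (subst eval_entire_sum) (auto intro!: entire_fps_mult simp: eval_entire_mult)
  thus ?thesis by (simp add: poly_altdef exp_of_nat_mult mult.assoc)
qed

text \<open>Write \<open>P = (X - 1) ^ k * Q\<close> with \<open>Q 1 \<noteq> 0\<close>. Since
  \<open>exp (\<beta> x) - 1 = x * e\<close> with \<open>e 0 = \<beta>\<close>, the factor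
  \<open>x ^ k\<close> is exactly what the shift in \<open>exp_poly\<close> removes.\<close>

lemma poly_fps_exp_factor:
  assumes P: "P \<noteq> 0" and \<beta>: "\<beta> \<noteq> 0"
  shows "poly_fps P (fps_exp \<beta>) = fps_X ^ order 1 P * exp_poly \<beta> P"
    and "fps_nth (exp_poly \<beta> P) 0 \<noteq> 0"
proof -
  define k where "k = order 1 P"
  obtain Q where Q: "P = [:- 1, 1:] ^ k * Q" "\<not> [:- 1, 1:] dvd Q"
    using order_decomp[OF P, of 1] by (auto simp: k_def)
  have Q1: "poly Q 1 \<noteq> 0" using Q(2) by (simp add: poly_eq_0_iff_dvd)
  define e where "e = fps_shift 1 (fps_exp \<beta> - 1)"
  have e: "fps_exp \<beta> - 1 = fps_X * e"
    by (rule fps_ext) (auto simp: e_def fps_X_mult_nth split: nat.splits)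
  have e0: "fps_nth e 0 = \<beta>" by (simp add: e_def)
  have lin: "poly_fps [:- 1, 1:] f = f - 1" for f
    by (simp add: map_poly_pCons numeral_fps_const)
  have "poly_fps P (fps_exp \<beta>) = (fps_exp \<beta> - 1) ^ k * poly_fps Q (fps_exp \<beta>)"
    unfolding Q(1) poly_fps_mult poly_fps_power lin ..
  hence eq: "poly_fps P (fps_exp \<beta>) = fps_X ^ k * (e ^ k * poly_fps Q (fps_exp \<beta>))"
    by (simp add: e power_mult_distrib mult.assoc)
  have ep: "exp_poly \<beta> P = e ^ k * poly_fps Q (fps_exp \<beta>)"
    unfolding exp_poly_def k_def[symmetric] eq mult.commute[of "fps_X ^ k"]
    by (rule fps_shift_times_fps_X_power')
  show "poly_fps P (fps_exp \<beta>) = fps_X ^ order 1 P * exp_poly \<beta> P" using eq ep by (simp add: k_def)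
  have "fps_nth (poly_fps Q (fps_exp \<beta>)) 0 = poly Q 1"
    using eval_poly_fps_exp[of Q \<beta> 0] by (simp add: eval_fps_at_0)
  thus "fps_nth (exp_poly \<beta> P) 0 \<noteq> 0" using ep e0 \<beta> Q1 by simp
qed

lemma exp_poly_entire: "entire_fps (exp_poly \<beta> P)"
  unfolding exp_poly_def by (intro entire_fps_shift poly_fps_exp_entire)

lemma exp_poly_mult:
  assumes "P \<noteq> 0" "Q \<noteq> 0" "\<beta> \<noteq> 0"
  shows "exp_poly \<beta> (P * Q) = exp_poly \<beta> P * exp_poly \<beta> Q"
proof -
  have "fps_X ^ order 1 (P * Q) * exp_poly \<beta> (P * Q) =
        fps_X ^ order 1 (P * Q) * (exp_poly \<beta> P * exp_poly \<beta> Q)"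
    using poly_fps_exp_factor(1)[of "P * Q" \<beta>] poly_fps_exp_factor(1)[of P \<beta>]
      poly_fps_exp_factor(1)[of Q \<beta>] assms
    by (simp add: poly_fps_mult order_mult power_add mult_ac)
  thus ?thesis by simp
qed

text \<open>The origin is exceptional: even if \<open>P 1 = 0\<close>, the zero there has been
  cancelled by the power of \<open>x\<close>.\<close>

lemma eval_exp_poly_eq_0_iff:
  assumes "P \<noteq> 0" "\<beta> \<noteq> 0"
  shows "eval_fps (exp_poly \<beta> P) z = 0 \<longleftrightarrow> z \<noteq> 0 \<and> poly P (exp (\<beta> * z)) = 0"
proof (cases "z = 0")
  case True
  thus ?thesis using poly_fps_exp_factor(2)[OF assms] by (simp add: eval_fps_at_0)
next
  case False
  have "poly P (exp (\<beta> * z)) = eval_fps (fps_X ^ order 1 P * exp_poly \<beta> P) z"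
    using poly_fps_exp_factor(1)[OF assms] by (simp flip: eval_poly_fps_exp)
  also have "\<dots> = z ^ order 1 P * eval_fps (exp_poly \<beta> P) z"
    using exp_poly_entire[of \<beta> P] by (simp add: eval_fps_mult entire_fps_def)
  finally show ?thesis using False by simp
qed

lemma simple_rep_zero_iff:
  assumes "simple_rep \<beta> P g" "\<beta> \<noteq> 0"
  shows "eval_fps g z = 0 \<longleftrightarrow> z \<noteq> 0 \<and> poly P (exp (\<beta> * z)) = 0"
proof -
  from assms obtain u where u: "poly P 0 \<noteq> 0" "E_unit u" "g = u * exp_poly \<beta> P"
    by (auto simp: simple_rep_def)
  hence "P \<noteq> 0" by auto
  thus ?thesis
    using u assms(2) by (simp add: eval_entire_mult E_unit_entire exp_poly_entire E_unit_eval_nonzero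
        eval_exp_poly_eq_0_iff)
qed

lemma simple_rep_entire: "simple_rep \<beta> P g \<Longrightarrow> entire_fps g"
  by (auto simp: simple_rep_def intro!: entire_fps_mult intro: E_unit_entire exp_poly_entire)

section \<open>Polynomial representations of simple functions\<close>

text \<open>Moving the smallest exponent \<open>m\<close> into the unit leaves non-negative
  exponents, one of them 0, and hence a polynomial with non-zero constant term. A second exponent
  makes its degree positive.\<close>

lemma simple_rep_exists:
  fixes c :: "nat \<Rightarrow> complex" and e :: "nat \<Rightarrow> int"
  assumes \<alpha>: "algebraic \<alpha>" and \<gamma>: "algebraic \<gamma>" "\<gamma> \<noteq> 0" and N: "N \<ge> 2"
    and c: "\<And>i. i < N \<Longrightarrow> algebraic (c i) \<and> c i \<noteq> 0" and e: "inj_on e {..<N}"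
    and g: "fps_X ^ \<omega> * g = fps_exp \<alpha> * (\<Sum>i<N. fps_const (c i) * fps_exp (\<gamma> * of_int (e i)))"
    and g0: "fps_nth g 0 \<noteq> 0"
  obtains P where "simple_rep \<gamma> P g" "degree P \<ge> 1"
proof -
  define m where "m = Min (e ` {..<N})"
  have "m \<in> e ` {..<N}" unfolding m_def using N by (intro Min_in) (auto simp: lessThan_empty_iff)
  then obtain i0 where i0: "i0 < N" "e i0 = m" by auto
  have m_le: "m \<le> e i" if "i < N" for i unfolding m_def using that by (intro Min_le) auto
  define f where "f = (\<lambda>i. nat (e i - m))"
  have f: "e i = m + int (f i)" if "i < N" for i using m_le[OF that] by (simp add: f_def)
  have f_inj: "f i = f j \<longleftrightarrow> i = j" if "i < N" "j < N" for i j
    using f[OF that(1)] f[OF that(2)] e that by (metis inj_onD lessThan_iff)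
  define P where "P = (\<Sum>i<N. monom (c i) (f i))"
  have coeff_P: "coeff P k = (\<Sum>i<N. if f i = k then c i else 0)" for k
    by (simp add: P_def coeff_sum)
  have coeff_f: "coeff P (f j) = c j" if "j < N" for j
  proof -
    have "coeff P (f j) = (\<Sum>i<N. if i = j then c i else 0)"
      unfolding coeff_P using that by (intro sum.cong) (auto simp: f_inj)
    thus ?thesis using that by simp
  qed
  have "algebraic (\<Sum>i\<in>S. if f i = k then c i else 0)" if "S \<subseteq> {..<N}" for S k
    using finite_subset[OF that finite_lessThan] that
    by (induction S rule: finite_induct) (auto intro: algebraic_add_complex simp: c)
  hence alg: "algebraic_poly P" unfolding algebraic_poly_def coeff_P by blast
  have f0: "f i0 = 0" using i0 by (simp add: f_def)
  have P0: "poly P 0 \<noteq> 0" using coeff_f[OF i0(1)] c[OF i0(1)] by (simp add: f0 poly_0_coeff_0)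
  hence P_nz: "P \<noteq> 0" by auto
  define j where "j = (if i0 = 0 then 1 else 0 :: nat)"
  have j: "j < N" "j \<noteq> i0" using N by (auto simp: j_def)
  hence "f j \<noteq> 0" using f_inj[OF j(1) i0(1)] f0 by simp
  moreover have "f j \<le> degree P" using coeff_f[OF j(1)] c[OF j(1)] by (intro le_degree) simp
  ultimately have deg: "degree P \<ge> 1" by simp
  define u where "u = fps_exp (\<alpha> + \<gamma> * of_int m)"
  have "algebraic (\<alpha> + \<gamma> * of_int m)"
    by (intro algebraic_add_complex algebraic_mult_complex \<alpha> \<gamma> rat_imp_algebraic) auto
  hence u: "E_unit u" unfolding u_def by (rule E_unit_fps_exp)
  have "poly_fps P (fps_exp \<gamma>) = (\<Sum>i<N. fps_const (c i) * fps_exp \<gamma> ^ f i)"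
  proof -
    have "map_poly fps_const P = (\<Sum>i<N. monom (fps_const (c i)) (f i))"
      by (rule poly_eqI) (auto simp: coeff_map_poly coeff_P coeff_sum fps_const_hom.hom_sum intro!: sum.cong)
    thus ?thesis by (simp add: poly_sum poly_monom)
  qed
  hence "u * poly_fps P (fps_exp \<gamma>) = (\<Sum>i<N. fps_const (c i) * (u * fps_exp \<gamma> ^ f i))"
    by (simp add: sum_distrib_left mult_ac)
  also have "\<dots> = (\<Sum>i<N. fps_const (c i) * (fps_exp \<alpha> * fps_exp (\<gamma> * of_int (e i))))"
    by (intro sum.cong refl)
       (simp add: u_def fps_exp_power_mult f algebra_simps flip: fps_exp_add_mult)
  also have "\<dots> = fps_X ^ \<omega> * g" unfolding g by (simp add: sum_distrib_left mult_ac)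
  finally have eq: "fps_X ^ \<omega> * g = fps_X ^ order 1 P * (u * exp_poly \<gamma> P)"
    using poly_fps_exp_factor(1)[OF P_nz \<gamma>(2)] by (simp add: mult_ac)
  have up: "fps_nth (u * exp_poly \<gamma> P) 0 \<noteq> 0"
    using poly_fps_exp_factor(2)[OF P_nz \<gamma>(2)] by (simp add: u_def)
  have sd: "subdegree (fps_X ^ n * h) = n" if "fps_nth h 0 \<noteq> 0" for n and h :: "complex fps"
    using that by (intro subdegreeI) (auto simp: fps_X_power_mult_nth)
  \<comment> \<open>Neither cofactor vanishes at 0, so comparing subdegrees identifies the two
    powers of \<open>x\<close>.\<close>
  have "\<omega> = order 1 P" using sd[OF g0, of \<omega>] sd[OF up, of "order 1 P"] eq by simp
  hence "g = u * exp_poly \<gamma> P" using eq by simp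
  hence "simple_rep \<gamma> P g" using alg P0 u unfolding simple_rep_def by blast
  thus ?thesis using deg that by blast
qed

lemma rat_common_denominator:
  assumes "finite X"
  shows "\<exists>M::nat. M > 0 \<and> (\<forall>x\<in>X. of_nat M * x \<in> (\<int> :: rat set))"
  using assms
proof (induction X rule: finite_induct)
  case (insert x X)
  then obtain M :: nat where M: "M > 0" "\<forall>x\<in>X. of_nat M * x \<in> (\<int> :: rat set)" by blast
  obtain p q where pq: "quotient_of x = (p, q)" by (cases "quotient_of x")
  have q: "q > 0" using quotient_of_denom_pos[OF pq] .
  have x: "x = of_int p / of_int q" using quotient_of_div[OF pq] .
  have "of_nat (nat q * M) * y \<in> (\<int> :: rat set)" if "y \<in> insert x X" for y
  proof (cases "y = x")
    case True
    hence "of_nat (nat q * M) * y = of_int (int M * p)" using q x by simp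
    thus ?thesis by (metis Ints_of_int)
  next
    case False
    hence "of_nat M * y \<in> \<int>" using that M by auto
    hence "of_nat (nat q) * (of_nat M * y) \<in> \<int>" by (rule Ints_mult[OF Ints_of_nat])
    thus ?thesis by (simp add: mult.assoc)
  qed
  thus ?case using M q by (intro exI[of _ "nat q * M"]) auto
qed auto

text \<open>\<open>M0\<close> clears the denominators of the exponents, written as rational
  multiples of \<open>\<beta>\<close>. Allowing all multiples of \<open>M0\<close> lets two
  functions with the same support share one exponential.\<close>

lemma simple_with_support_rep:
  assumes g: "simple_with_support V g" and V: "V = rat_span \<beta>" and \<beta>: "algebraic \<beta>" "\<beta> \<noteq> 0"
  obtains M0 :: nat where "M0 > 0"
    "\<And>M. M > 0 \<Longrightarrow> M0 dvd M \<Longrightarrow> \<exists>P. simple_rep (\<beta> / of_nat M) P g \<and> degree P \<ge> 1"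
proof -
  from g obtain \<omega> N :: nat and \<alpha> \<delta> :: complex and c :: "nat \<Rightarrow> complex" and r :: "nat \<Rightarrow> rat"
    where alg: "algebraic \<alpha>" and \<delta>: "\<delta> \<noteq> 0" and N: "N \<ge> 2"
      and c: "\<forall>i<N. algebraic (c i) \<and> c i \<noteq> 0" and r: "inj_on r {..<N}"
      and eq: "fps_X ^ \<omega> * g = fps_exp \<alpha> * (\<Sum>i<N. fps_const (c i) * fps_exp (\<delta> * of_rat (r i)))"
      and g0: "fps_nth g 0 \<noteq> 0" and V': "V = rat_span \<delta>"
    unfolding simple_with_support_def by blast
  have "\<delta> \<in> rat_span \<delta>" unfolding rat_span_def by (intro range_eqI[of _ _ 1]) simp
  then obtain \<rho> where \<rho>: "\<delta> = of_rat \<rho> * \<beta>" using V V' by (auto simp: rat_span_def)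
  have \<rho>0: "\<rho> \<noteq> 0" using \<rho> \<delta> by auto
  obtain M0 :: nat where M0: "M0 > 0" "\<forall>x\<in>(\<lambda>i. \<rho> * r i) ` {..<N}. of_nat M0 * x \<in> \<int>"
    using rat_common_denominator[of "(\<lambda>i. \<rho> * r i) ` {..<N}"] by blast
  have "\<exists>P. simple_rep (\<beta> / of_nat M) P g \<and> degree P \<ge> 1" if M: "M > 0" "M0 dvd M" for M
  proof -
    have int: "of_nat M * (\<rho> * r i) \<in> \<int>" if "i < N" for i
    proof -
      obtain k where "M = M0 * k" using M(2) by (elim dvdE)
      hence "of_nat M * (\<rho> * r i) = of_nat k * (of_nat M0 * (\<rho> * r i))" by simp
      moreover have "of_nat M0 * (\<rho> * r i) \<in> \<int>" using M0(2) that by blast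
      ultimately show ?thesis by (metis Ints_mult Ints_of_nat)
    qed
    hence "\<forall>i. \<exists>z::int. i < N \<longrightarrow> of_nat M * (\<rho> * r i) = of_int z" by (metis Ints_cases)
    then obtain e :: "nat \<Rightarrow> int" where e: "\<And>i. i < N \<Longrightarrow> of_nat M * (\<rho> * r i) = of_int (e i)" by metis
    have e_inj: "inj_on e {..<N}"
    proof (rule inj_onI)
      fix i j assume ij: "i \<in> {..<N}" "j \<in> {..<N}" "e i = e j"
      hence "of_nat M * (\<rho> * r i) = of_nat M * (\<rho> * r j)" using e by simp
      hence "r i = r j" using M \<rho>0 by simp
      thus "i = j" using r ij by (auto dest: inj_onD)
    qed
    have exponent: "\<beta> / of_nat M * of_int (e i) = \<delta> * of_rat (r i)" if "i < N" for i
    proof -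
      have "(of_int (e i) :: complex) = of_rat (of_int (e i))" by simp
      also have "\<dots> = of_nat M * (of_rat \<rho> * of_rat (r i))" using e[OF that] by (simp add: of_rat_mult flip: e[OF that])
      finally show ?thesis using M by (simp add: \<rho> mult_ac)
    qed
    have eq': "fps_X ^ \<omega> * g = fps_exp \<alpha> * (\<Sum>i<N. fps_const (c i) * fps_exp (\<beta> / of_nat M * of_int (e i)))"
      unfolding eq by (intro arg_cong2[where f = "(*)"] sum.cong refl) (simp only: exponent lessThan_iff)
    have "algebraic (\<beta> * inverse (of_nat M))"
      by (intro algebraic_mult_complex algebraic_inverse \<beta> rat_imp_algebraic) auto
    hence "algebraic (\<beta> / of_nat M)" by (simp add: divide_inverse)
    thus ?thesis
      using simple_rep_exists[OF alg _ _ N _ e_inj eq' g0] \<beta>(2) M(1) c by (metis divide_eq_0_iff of_nat_eq_0_iff less_numeral_extra(3))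
  qed
  with M0(1) that show ?thesis by blast
qed

lemma rat_span_div_nat:
  assumes "M > 0"
  shows "rat_span (\<beta> / of_nat M) = rat_span \<beta>"
proof (intro equalityI subsetI)
  fix x assume "x \<in> rat_span (\<beta> / of_nat M)"
  then obtain q where "x = of_rat q * (\<beta> / of_nat M)" by (auto simp: rat_span_def)
  hence "x = of_rat (q / of_nat M) * \<beta>" by (simp add: of_rat_divide)
  thus "x \<in> rat_span \<beta>" by (auto simp: rat_span_def)
next
  fix x assume "x \<in> rat_span \<beta>"
  then obtain q where "x = of_rat q * \<beta>" by (auto simp: rat_span_def)
  hence "x = of_rat (q * of_nat M) * (\<beta> / of_nat M)" using assms by (simp add: of_rat_mult)
  thus "x \<in> rat_span (\<beta> / of_nat M)" unfolding rat_span_def by blast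
qed

lemma simple_with_support_generator:
  assumes "simple_with_support V g"
  obtains \<beta> where "algebraic \<beta>" "\<beta> \<noteq> 0" "V = rat_span \<beta>"
  using assms unfolding simple_with_support_def by blast

lemma algebraic_div_nat: "algebraic \<beta> \<Longrightarrow> algebraic (\<beta> / of_nat M :: complex)"
  unfolding divide_inverse
  by (rule algebraic_mult_complex, assumption, intro algebraic_inverse rat_imp_algebraic) auto

lemma simple_reps_common:
  assumes "simple_with_support V g1" "simple_with_support V g2"
  obtains \<beta> P1 P2 where "algebraic \<beta>" "\<beta> \<noteq> 0" "V = rat_span \<beta>" "simple_rep \<beta> P1 g1" "simple_rep \<beta> P2 g2" "degree P1 \<ge> 1"
proof -
  obtain \<delta> where \<delta>: "algebraic \<delta>" "\<delta> \<noteq> 0" "V = rat_span \<delta>"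
    using simple_with_support_generator[OF assms(1)] .
  obtain M1 :: nat where M1: "M1 > 0"
    "\<And>M. M > 0 \<Longrightarrow> M1 dvd M \<Longrightarrow> \<exists>P. simple_rep (\<delta> / of_nat M) P g1 \<and> degree P \<ge> 1"
    using simple_with_support_rep[OF assms(1) \<delta>(3,1,2)] by blast
  obtain M2 :: nat where M2: "M2 > 0"
    "\<And>M. M > 0 \<Longrightarrow> M2 dvd M \<Longrightarrow> \<exists>P. simple_rep (\<delta> / of_nat M) P g2 \<and> degree P \<ge> 1"
    using simple_with_support_rep[OF assms(2) \<delta>(3,1,2)] by blast
  obtain P1 P2 where "simple_rep (\<delta> / of_nat (M1 * M2)) P1 g1 \<and> degree P1 \<ge> 1" "simple_rep (\<delta> / of_nat (M1 * M2)) P2 g2"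
    using M1(2)[of "M1 * M2"] M2(2)[of "M1 * M2"] M1(1) M2(1) by auto
  moreover have "algebraic (\<delta> / of_nat (M1 * M2))" using \<delta>(1) by (rule algebraic_div_nat)
  moreover have "V = rat_span (\<delta> / of_nat (M1 * M2))" using \<delta>(3) M1(1) M2(1) by (subst rat_span_div_nat) auto
  moreover have "\<delta> / of_nat (M1 * M2) \<noteq> 0" using \<delta>(2) M1(1) M2(1) by simp
  ultimately show ?thesis using that by blast
qed

lemma simple_entire: "simple_with_support V g \<Longrightarrow> entire_fps g"
  by (metis simple_reps_common simple_rep_entire)

section \<open>Zeros and supports\<close>

text \<open>A non-constant \<open>P\<close> with \<open>P 0 \<noteq> 0\<close> has a non-zero root,
  and every non-zero number is a value of the exponential.\<close>

lemma simple_has_zero: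
  assumes "simple_with_support V g"
  shows "\<exists>z. eval_fps g z = 0"
proof -
  obtain \<beta> P where \<beta>: "\<beta> \<noteq> 0" and P: "simple_rep \<beta> P g" "degree P \<ge> 1"
    using simple_reps_common[OF assms assms] by metis
  have "\<not> constant (poly P)" using P(2) by (simp add: constant_degree)
  then obtain \<rho> where \<rho>: "poly P \<rho> = 0" using fundamental_theorem_of_algebra by blast
  hence "\<rho> \<noteq> 0" using P(1) by (auto simp: simple_rep_def)
  \<comment> \<open>Adding \<open>2 \<pi> \<i>\<close> keeps the zero away from the origin when \<open>\<rho> = 1\<close>.\<close>
  define z where "z = (Ln \<rho> + 2 * of_real pi * \<i>) / \<beta>"
  have "Im (Ln \<rho> + 2 * of_real pi * \<i>) > 0" using mpi_less_Im_Ln[OF \<open>\<rho> \<noteq> 0\<close>] pi_gt_zero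
    by (simp, linarith)
  hence "Ln \<rho> + 2 * of_real pi * \<i> \<noteq> 0" by (metis less_irrefl zero_complex.sel(2))
  hence "z \<noteq> 0" using \<beta> by (simp add: z_def)
  moreover have "exp (\<beta> * z) = \<rho>" using \<beta> \<open>\<rho> \<noteq> 0\<close> by (simp add: z_def exp_add)
  ultimately show ?thesis using simple_rep_zero_iff[OF P(1) \<beta>] \<rho> by blast
qed

text \<open>At a zero, \<open>exp (\<beta> * z)\<close> is a root of a polynomial with algebraic
  coefficients. The conclusion is the common input of \<open>gelfond_schneider\<close> and
  \<open>conjecture_Z\<close>.\<close>

lemma simple_zero:
  assumes "simple_with_support V g" "eval_fps g z = 0"
  obtains \<beta> where "z \<noteq> 0" "algebraic \<beta>" "\<beta> \<noteq> 0" "V = rat_span \<beta>" "algebraic (exp (\<beta> * z))"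
proof -
  obtain \<beta> P where \<beta>: "algebraic \<beta>" "\<beta> \<noteq> 0" "V = rat_span \<beta>" and P: "simple_rep \<beta> P g"
    using simple_reps_common[OF assms(1) assms(1)] by metis
  have "z \<noteq> 0" "poly P (exp (\<beta> * z)) = 0" using simple_rep_zero_iff[OF P \<beta>(2)] assms(2) by auto
  moreover have "algebraic_poly P" "P \<noteq> 0" using P by (auto simp: simple_rep_def)
  ultimately show ?thesis using that[OF _ \<beta>] algebraic_root_of_algebraic_poly by blast
qed

lemma rat_span_eqI:
  assumes "a \<noteq> 0" "b \<noteq> 0" "of_int i * a + of_int j * b = 0" "i \<noteq> 0 \<or> j \<noteq> 0"
  shows "rat_span a = rat_span b"
proof -
  have ij: "i \<noteq> 0" "j \<noteq> 0" using assms by auto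
  define \<rho> :: rat where "\<rho> = - of_int j / of_int i"
  have \<rho>: "a = of_rat \<rho> * b"
    using assms(3) ij by (simp add: \<rho>_def of_rat_divide of_rat_minus field_simps eq_neg_iff_add_eq_0)
  have \<rho>0: "\<rho> \<noteq> 0" using ij by (simp add: \<rho>_def)
  show ?thesis
  proof (intro equalityI subsetI)
    fix x assume "x \<in> rat_span a"
    then obtain q where "x = of_rat q * a" by (auto simp: rat_span_def)
    hence "x = of_rat (q * \<rho>) * b" by (simp add: \<rho> of_rat_mult)
    thus "x \<in> rat_span b" unfolding rat_span_def by blast
  next
    fix x assume "x \<in> rat_span b"
    then obtain q where "x = of_rat q * b" by (auto simp: rat_span_def)
    hence "x = of_rat (q / \<rho>) * a" using \<rho>0 by (simp add: \<rho> of_rat_divide)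
    thus "x \<in> rat_span a" unfolding rat_span_def by blast
  qed
qed

lemma simple_common_zero_imp_same_support:
  assumes g1: "simple_with_support V g1" "eval_fps g1 z = 0"
    and g2: "simple_with_support W g2" "eval_fps g2 z = 0"
  shows "V = W"
proof (rule ccontr)
  assume VW: "V \<noteq> W"
  obtain a where a: "z \<noteq> 0" "algebraic a" "a \<noteq> 0" "V = rat_span a" "algebraic (exp (a * z))"
    using simple_zero[OF g1] .
  obtain b where b: "algebraic b" "b \<noteq> 0" "W = rat_span b" "algebraic (exp (b * z))"
    using simple_zero[OF g2] .
  show False
  proof (rule gelfond_schneider[OF a(2) b(1) a(1) a(5) b(4)])
    fix i j :: int assume "of_int i * a + of_int j * b = 0"
    thus "i = 0 \<and> j = 0" using rat_span_eqI[OF a(3) b(2), of i j] VW a(4) b(3) by blast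
  qed
qed

lemma simple_support_unique:
  "simple_with_support V g \<Longrightarrow> simple_with_support W g \<Longrightarrow> V = W"
  using simple_has_zero simple_common_zero_imp_same_support by blast

text \<open>1 is the value of \<open>simple_part\<close> at a line that supports no factor. As it is
  not simple itself, \<open>simple_gcd\<close> with it takes the intended value 1.\<close>

lemma one_not_simple: "\<not> simple_with_support V 1"
  using simple_has_zero[of V 1] by auto

section \<open>Entire cofactors without common zero\<close>

text \<open>Naming the cofactors avoids division of series in the arguments; both forms of the
  conclusion follow from this predicate when \<open>f1\<close> and \<open>f2\<close> are
  non-zero.\<close>

definition coprime_quotients :: "complex fps \<Rightarrow> complex fps \<Rightarrow> complex fps \<Rightarrow> complex fps \<Rightarrow> complex fps \<Rightarrow> bool" where
  "coprime_quotients f1 f2 d q1 q2 \<longleftrightarrow> f1 = d * q1 \<and> f2 = d * q2 \<and>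
     entire_fps d \<and> entire_fps q1 \<and> entire_fps q2 \<and> (\<forall>z. \<not> (eval_fps q1 z = 0 \<and> eval_fps q2 z = 0))"

lemma coprime_quotients_imp_quotients_without_common_zero:
  assumes "coprime_quotients f1 f2 d q1 q2" "f1 \<noteq> 0"
  shows "quotients_without_common_zero f1 f2 d"
proof -
  have "d \<noteq> 0" using assms by (auto simp: coprime_quotients_def)
  hence "f1 / d = q1" "f2 / d = q2" using assms by (simp_all add: coprime_quotients_def)
  thus ?thesis using assms
    unfolding coprime_quotients_def quotients_without_common_zero_def entire_fps_def by auto
qed

text \<open>By the identity theorem; additivity of \<open>zorder\<close> requires functions that do
  not vanish identically near \<open>z\<close>.\<close>

lemma entire_fps_eventually_nonzero:
  assumes "entire_fps f" "f \<noteq> 0"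
  shows "eventually (\<lambda>w. eval_fps f w \<noteq> 0) (at z)"
proof -
  have "\<exists>w. eval_fps f w \<noteq> 0"
  proof (rule ccontr)
    assume "\<not> (\<exists>w. eval_fps f w \<noteq> 0)"
    hence "eval_fps f = (\<lambda>_. 0)" by auto
    moreover have "eval_fps f has_fps_expansion f"
      using assms(1) by (intro eval_fps_has_fps_expansion) (auto simp: entire_fps_def)
    ultimately have "(\<lambda>_. 0) has_fps_expansion f" by simp
    moreover have "(\<lambda>_::complex. 0) has_fps_expansion (0 :: complex fps)" by simp
    ultimately have "f = 0" using fps_expansion_unique_complex by blast
    thus False using assms(2) by simp
  qed
  then obtain w where "eval_fps f w \<noteq> 0" by blast
  from non_zero_neighbour_alt[OF holomorphic_eval_entire[OF assms(1)] open_UNIV connected_UNIV UNIV_I UNIV_I this]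
  show ?thesis by simp
qed

lemma zorder_eval_entire_mult:
  assumes "entire_fps f" "entire_fps g" "f * g \<noteq> 0"
  shows "zorder (eval_fps (f * g)) z = zorder (eval_fps f) z + zorder (eval_fps g) z"
proof -
  have an: "eval_fps h analytic_on {z}" if "entire_fps h" for h
    using holomorphic_eval_entire[OF that, of UNIV] analytic_at by blast
  have eq: "eval_fps (f * g) = (\<lambda>z. eval_fps f z * eval_fps g z)"
    using assms by (auto simp: eval_entire_mult)
  show ?thesis unfolding eq
    using entire_fps_eventually_nonzero[OF entire_fps_mult[OF assms(1,2)] assms(3), of z]
    by (intro zorder_times_analytic an assms) (simp add: eq)
qed

lemma zorder_eval_entire_ge_0:
  assumes "entire_fps f" "f \<noteq> 0"
  shows "zorder (eval_fps f) z \<ge> 0"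
proof (rule zorder_ge_0)
  show "eval_fps f analytic_on {z}" using holomorphic_eval_entire[OF assms(1), of UNIV] analytic_at by blast
  show "frequently (\<lambda>w. eval_fps f w \<noteq> 0) (at z)"
    using entire_fps_eventually_nonzero[OF assms] by (intro eventually_frequently) auto
qed

lemma zorder_eval_entire_eq_0:
  assumes "entire_fps f" "eval_fps f z \<noteq> 0"
  shows "zorder (eval_fps f) z = 0"
  using holomorphic_eval_entire[OF assms(1), of UNIV] analytic_at assms(2) by (intro zorder_eq_0I) blast+

text \<open>Orders add, and at each point one cofactor has order 0 and the other a non-negative
  order; so the smaller of the two sums is the order of \<open>d\<close>.\<close>

lemma coprime_quotients_imp_common_zeros:
  assumes q: "coprime_quotients f1 f2 d q1 q2" and nz: "f1 \<noteq> 0" "f2 \<noteq> 0"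
  shows "common_zeros_with_min_order f1 f2 d"
proof -
  have f: "f1 = d * q1" "f2 = d * q2" and ent: "entire_fps d" "entire_fps q1" "entire_fps q2"
    and co: "\<And>z. \<not> (eval_fps q1 z = 0 \<and> eval_fps q2 z = 0)"
    using q by (auto simp: coprime_quotients_def)
  have q_nz: "q1 \<noteq> 0" "q2 \<noteq> 0" using nz f by auto
  have "zorder (eval_fps d) z = min (zorder (eval_fps f1) z) (zorder (eval_fps f2) z)" for z
  proof -
    have "zorder (eval_fps f1) z = zorder (eval_fps d) z + zorder (eval_fps q1) z"
         "zorder (eval_fps f2) z = zorder (eval_fps d) z + zorder (eval_fps q2) z"
      using zorder_eval_entire_mult ent nz f by auto
    moreover have "zorder (eval_fps q1) z = 0 \<or> zorder (eval_fps q2) z = 0"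
      using co[of z] zorder_eval_entire_eq_0 ent by blast
    moreover have "zorder (eval_fps q1) z \<ge> 0" "zorder (eval_fps q2) z \<ge> 0"
      using zorder_eval_entire_ge_0 ent q_nz by blast+
    ultimately show ?thesis by linarith
  qed
  moreover have "eval_fps f1 z = 0 \<and> eval_fps f2 z = 0 \<longleftrightarrow> eval_fps d z = 0" for z
    using co[of z] by (auto simp: f eval_entire_mult ent)
  ultimately show ?thesis unfolding common_zeros_with_min_order_def by auto
qed

text \<open>Dividing \<open>P1\<close> and \<open>P2\<close> by their gcd leaves polynomials without
  common root, and by multiplicativity of \<open>exp_poly\<close> this becomes a factorization of
  series.\<close>

lemma simple_gcd_coprime_quotients_same_support:
  assumes "simple_with_support V g1" "simple_with_support V g2"
  shows "\<exists>q1 q2. coprime_quotients g1 g2 (simple_gcd g1 g2) q1 q2"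
proof -
  define Q where "Q = (\<lambda>d. \<exists>V \<beta> P1 P2. simple_with_support V g1 \<and> simple_with_support V g2 \<and> \<beta> \<in> V - {0} \<and>
             simple_rep \<beta> P1 g1 \<and> simple_rep \<beta> P2 g2 \<and> d = exp_poly \<beta> (gcd P1 P2))"
  obtain \<beta> P1 P2 where "algebraic \<beta>" "\<beta> \<noteq> 0" "V = rat_span \<beta>" "simple_rep \<beta> P1 g1" "simple_rep \<beta> P2 g2"
    using simple_reps_common[OF assms] by metis
  moreover have "\<beta> \<in> rat_span \<beta>" unfolding rat_span_def by (intro range_eqI[of _ _ 1]) simp
  ultimately have "Q (exp_poly \<beta> (gcd P1 P2))" unfolding Q_def using assms by blast
  hence "Q (SOME d. Q d)" by (rule someI)
  moreover have "simple_gcd g1 g2 = (SOME d. Q d)"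
    unfolding simple_gcd_def Q_def using assms by auto
  \<comment> \<open>From here on, \<open>\<beta>\<close>, \<open>P1\<close>, \<open>P2\<close>
    belong to the value picked by \<open>SOME\<close>; the previous ones only showed that there is
    something to pick.\<close>
  ultimately obtain \<beta> P1 P2 where \<beta>: "\<beta> \<noteq> 0" and P: "simple_rep \<beta> P1 g1" "simple_rep \<beta> P2 g2"
    and d: "simple_gcd g1 g2 = exp_poly \<beta> (gcd P1 P2)" unfolding Q_def by auto
  obtain u1 where u1: "poly P1 0 \<noteq> 0" "E_unit u1" "g1 = u1 * exp_poly \<beta> P1" using P by (auto simp: simple_rep_def)
  obtain u2 where u2: "poly P2 0 \<noteq> 0" "E_unit u2" "g2 = u2 * exp_poly \<beta> P2" using P by (auto simp: simple_rep_def)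
  define D where "D = gcd P1 P2"
  have nz: "P1 \<noteq> 0" "P2 \<noteq> 0" using u1 u2 by auto
  hence D: "D \<noteq> 0" by (simp add: D_def)
  define Q1 where "Q1 = P1 div D"
  define Q2 where "Q2 = P2 div D"
  have PQ: "P1 = D * Q1" "P2 = D * Q2" by (simp_all add: D_def Q1_def Q2_def)
  have Q_nz: "Q1 \<noteq> 0" "Q2 \<noteq> 0" using PQ nz by auto
  have cop: "coprime Q1 Q2" unfolding Q1_def Q2_def D_def using nz by (intro div_gcd_coprime) auto
  have "coprime_quotients g1 g2 (exp_poly \<beta> D) (u1 * exp_poly \<beta> Q1) (u2 * exp_poly \<beta> Q2)"
    unfolding coprime_quotients_def
  proof (intro conjI allI)
    show "g1 = exp_poly \<beta> D * (u1 * exp_poly \<beta> Q1)" "g2 = exp_poly \<beta> D * (u2 * exp_poly \<beta> Q2)"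
      using u1(3) u2(3) PQ exp_poly_mult[OF D Q_nz(1) \<beta>] exp_poly_mult[OF D Q_nz(2) \<beta>] by (simp_all add: mult_ac)
    fix z
    show "\<not> (eval_fps (u1 * exp_poly \<beta> Q1) z = 0 \<and> eval_fps (u2 * exp_poly \<beta> Q2) z = 0)"
      using coprime_poly_0[OF cop, of "exp (\<beta> * z)"] E_unit_eval_nonzero u1(2) u2(2)
      by (auto simp: eval_entire_mult E_unit_entire exp_poly_entire eval_exp_poly_eq_0_iff Q_nz \<beta>)
  qed (auto intro!: entire_fps_mult exp_poly_entire intro: E_unit_entire u1 u2)
  thus ?thesis unfolding d D_def by blast
qed

lemma simple_gcd_different_support:
  assumes "\<And>V. \<not> (simple_with_support V g1 \<and> simple_with_support V g2)"
  shows "simple_gcd g1 g2 = 1"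
  using assms unfolding simple_gcd_def by auto

lemma simple_gcd_coprime_quotients:
  assumes "E_simple g1" "E_simple g2"
  shows "\<exists>q1 q2. coprime_quotients g1 g2 (simple_gcd g1 g2) q1 q2"
proof (cases "\<exists>V. simple_with_support V g1 \<and> simple_with_support V g2")
  case True
  thus ?thesis using simple_gcd_coprime_quotients_same_support by blast
next
  case False
  hence d: "simple_gcd g1 g2 = 1" by (intro simple_gcd_different_support) blast
  from assms obtain V W where VW: "simple_with_support V g1" "simple_with_support W g2"
    unfolding E_simple_def by blast
  have "\<not> (eval_fps g1 z = 0 \<and> eval_fps g2 z = 0)" for z
    using False VW simple_common_zero_imp_same_support by blast
  thus ?thesis unfolding d using VW simple_entire
    by (intro exI[of _ g1] exI[of _ g2]) (auto simp: coprime_quotients_def)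
qed

lemma simple_nonzero: "simple_with_support V g \<Longrightarrow> g \<noteq> 0"
  unfolding simple_with_support_def by auto

section \<open>The gcd of two E-functions\<close>

lemma normalized_nonzero: "normalized f \<Longrightarrow> f \<noteq> 0"
  unfolding normalized_def by auto

lemma E_factorization_the_factorization:
  assumes "conjecture_F" "E_function f" "f \<noteq> 0"
  shows "E_factorization f (the_factorization f)"
proof -
  have "\<exists>!F. E_factorization f F" using assms unfolding conjecture_F_def by blast
  thus ?thesis unfolding the_factorization_def by (rule theI')
qed

text \<open>Both \<open>1 * h1\<close> and \<open>u * h2\<close> are factorizations of \<open>h1\<close>.\<close>

lemma irreducible_common_zero_imp_eq:
  assumes F: "conjecture_F" and I: "conjecture_I"
    and h1: "E_irreducible h1" "normalized h1" "eval_fps h1 z = 0"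
    and h2: "E_irreducible h2" "normalized h2" "eval_fps h2 z = 0"
  shows "h1 = h2"
proof -
  obtain u where u: "E_unit u" "h1 = u * h2" using I h1 h2 unfolding conjecture_I_def by blast
  have "E_factorization h1 (1, {}, {#h1#})" "E_factorization h1 (u, {}, {#h2#})"
    using u h1 h2 E_unit_one unfolding E_factorization_def by auto
  moreover have "\<exists>!F. E_factorization h1 F"
    using F h1(1) normalized_nonzero[OF h1(2)] unfolding conjecture_F_def E_irreducible_def by blast
  ultimately have "(1, {}, {#h1#}) = (u, {} :: complex fps set, {#h2#})" by blast
  thus ?thesis by simp
qed

section \<open>Simple and irreducible parts of a factorization\<close>

text \<open>A factorization stores its simple factors as a set, whereas the gcd is a product over
  lines; \<open>supports\<close> and \<open>the_support\<close> translate between the two.\<close>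

definition supports :: "complex fps set \<Rightarrow> complex set set" where
  "supports S = {V. \<exists>s\<in>S. simple_with_support V s}"

definition the_support :: "complex fps \<Rightarrow> complex set" where
  "the_support s = (THE V. simple_with_support V s)"

lemma the_support_eq: "simple_with_support V s \<Longrightarrow> the_support s = V"
  unfolding the_support_def by (rule the_equality, assumption, rule simple_support_unique)

lemma simple_with_the_support: "E_simple s \<Longrightarrow> simple_with_support (the_support s) s"
  using the_support_eq unfolding E_simple_def by metis

lemma supports_eq_image: "(\<And>s. s \<in> S \<Longrightarrow> E_simple s) \<Longrightarrow> supports S = the_support ` S"
  using simple_with_the_support the_support_eq unfolding supports_def by (auto simp: image_iff) blast+

context
  fixes f u :: "complex fps" and S :: "complex fps set" and H :: "complex fps multiset"
  assumes fact: "E_factorization f (u, S, H)" and the_fact: "the_factorization f = (u, S, H)"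
begin

lemma finite_supports: "finite (supports S)"
  using fact supports_eq_image[of S] unfolding E_factorization_def by auto

lemma simple_part_eq_factor:
  assumes "s \<in> S" "simple_with_support V s"
  shows "simple_part V f = s"
proof -
  have "(THE t. t \<in> S \<and> simple_with_support V t) = s"
    using assms fact unfolding E_factorization_def by (intro the_equality) auto
  thus ?thesis using assms unfolding simple_part_def the_fact by auto
qed

lemma simple_part_eq_one: "V \<notin> supports S \<Longrightarrow> simple_part V f = 1"
  unfolding simple_part_def the_fact supports_def by auto

lemma simple_part_cases: "simple_part V f = 1 \<or> simple_with_support V (simple_part V f)"
  using simple_part_eq_factor simple_part_eq_one unfolding supports_def by blast

text \<open>Outside \<open>supports S\<close> the simple part is 1, so two functions can be given
  one index set. Distinctness of the supports makes \<open>the_support\<close> injective on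
  \<open>S\<close>.\<close>

lemma prod_simple_part:
  assumes "finite \<V>" "supports S \<subseteq> \<V>"
  shows "(\<Prod>V\<in>\<V>. simple_part V f) = \<Prod>S"
proof -
  have simple: "\<And>s. s \<in> S \<Longrightarrow> E_simple s" using fact unfolding E_factorization_def by auto
  have inj: "inj_on the_support S"
  proof (rule inj_onI)
    fix s t assume "s \<in> S" "t \<in> S" "the_support s = the_support t"
    moreover from this simple have "simple_with_support (the_support s) s" "simple_with_support (the_support s) t"
      by (metis simple_with_the_support)+
    ultimately show "s = t" using fact unfolding E_factorization_def by blast
  qed
  have "(\<Prod>V\<in>\<V>. simple_part V f) = (\<Prod>V\<in>the_support ` S. simple_part V f)"
    using assms simple_part_eq_one supports_eq_image[OF simple] by (intro prod.mono_neutral_right) auto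
  also have "\<dots> = (\<Prod>s\<in>S. simple_part (the_support s) f)" using inj by (simp add: prod.reindex)
  also have "\<dots> = \<Prod>S"
    using simple simple_part_eq_factor simple_with_the_support by (intro prod.cong) auto
  finally show ?thesis .
qed

lemma irreducible_mult_eq_count: "irreducible_mult h f = count H h"
  by (simp add: irreducible_mult_def the_fact)

end

lemma simple_gcd_one: "simple_gcd 1 g = 1" "simple_gcd g 1 = 1"
  using one_not_simple by (auto intro: simple_gcd_different_support)

lemma rational_line_support: "simple_with_support V g \<Longrightarrow> rational_line V"
  by (metis rational_line_def simple_with_support_generator)

text \<open>Turns the irreducible part of the gcd into a product over a multiset intersection, whose
  multiplicities are the minima.\<close>

lemma prod_mset_inter:
  "(\<Prod>h | h \<in># H \<and> min (count H h) (count K h) \<noteq> 0. h ^ min (count H h) (count K h)) = prod_mset (H \<inter># K)"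
proof -
  have "{h. h \<in># H \<and> min (count H h) (count K h) \<noteq> 0} = set_mset (H \<inter># K)"
    by (auto simp flip: count_greater_zero_iff simp: min_def)
  thus ?thesis by (simp add: prod_mset_multiplicity)
qed

text \<open>The cofactor \<open>r1\<close> collects the unit, the cofactors \<open>q1 V\<close> of
  the simple parts and the irreducible factors in excess of the common ones; likewise
  \<open>r2\<close>. A common zero belongs to one simple or irreducible factor on each side, and all
  four combinations are excluded.\<close>

lemma E_gcd_coprime_quotients:
  assumes F: "conjecture_F" and I: "conjecture_I" and Z: "conjecture_Z"
    and f1: "E_function f1" "f1 \<noteq> 0" and f2: "E_function f2" "f2 \<noteq> 0"
  shows "\<exists>q1 q2. coprime_quotients f1 f2 (E_gcd f1 f2) q1 q2"
proof -
  obtain u1 S1 H1 where t1: "the_factorization f1 = (u1, S1, H1)" using prod_cases3 by blast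
  obtain u2 S2 H2 where t2: "the_factorization f2 = (u2, S2, H2)" using prod_cases3 by blast
  have e1: "E_factorization f1 (u1, S1, H1)" using E_factorization_the_factorization[OF F f1] t1 by simp
  have e2: "E_factorization f2 (u2, S2, H2)" using E_factorization_the_factorization[OF F f2] t2 by simp
  have u: "E_unit u1" "E_unit u2" using e1 e2 by (auto simp: E_factorization_def)
  have H: "E_irreducible h \<and> normalized h" if "h \<in># H1 \<or> h \<in># H2" for h
    using e1 e2 that by (auto simp: E_factorization_def)
  have f1_eq: "f1 = u1 * \<Prod>S1 * prod_mset H1" and f2_eq: "f2 = u2 * \<Prod>S2 * prod_mset H2"
    using e1 e2 by (auto simp: E_factorization_def)
  define \<V> where "\<V> = supports S1 \<union> supports S2"
  have fin: "finite \<V>" using finite_supports[OF e1 t1] finite_supports[OF e2 t2] by (simp add: \<V>_def)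
  define p1 where "p1 = (\<lambda>V. simple_part V f1)"
  define p2 where "p2 = (\<lambda>V. simple_part V f2)"
  define g where "g = (\<lambda>V. simple_gcd (p1 V) (p2 V))"
  have p1: "p1 V = 1 \<or> simple_with_support V (p1 V)" for V
    unfolding p1_def by (rule simple_part_cases[OF e1 t1])
  have p2: "p2 V = 1 \<or> simple_with_support V (p2 V)" for V
    unfolding p2_def by (rule simple_part_cases[OF e2 t2])
  have prod1: "(\<Prod>V\<in>\<V>. p1 V) = \<Prod>S1"
    unfolding p1_def by (rule prod_simple_part[OF e1 t1 fin]) (simp add: \<V>_def)
  have prod2: "(\<Prod>V\<in>\<V>. p2 V) = \<Prod>S2"
    unfolding p2_def by (rule prod_simple_part[OF e2 t2 fin]) (simp add: \<V>_def)
  have "\<exists>q1 q2. coprime_quotients (p1 V) (p2 V) (g V) q1 q2" for V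
  proof (cases "p1 V = 1 \<or> p2 V = 1")
    case True
    hence "g V = 1" using simple_gcd_one by (auto simp: g_def)
    moreover have "entire_fps (p1 V)" "entire_fps (p2 V)" using p1[of V] p2[of V] simple_entire by auto
    ultimately show ?thesis using True
      by (intro exI[of _ "p1 V"] exI[of _ "p2 V"]) (auto simp: coprime_quotients_def)
  next
    case False
    thus ?thesis using p1[of V] p2[of V] simple_gcd_coprime_quotients_same_support unfolding g_def by blast
  qed
  then obtain q1 q2 where q: "\<And>V. coprime_quotients (p1 V) (p2 V) (g V) (q1 V) (q2 V)" by metis
  hence pq: "p1 V = g V * q1 V" "p2 V = g V * q2 V"
    and ent: "entire_fps (g V)" "entire_fps (q1 V)" "entire_fps (q2 V)" for V
    by (auto simp: coprime_quotients_def)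
  define M where "M = H1 \<inter># H2"
  have HM: "H1 = M + (H1 - M)" "H2 = M + (H2 - M)" by (rule multiset_eqI, simp add: M_def)+
  have gcd_eq: "E_gcd f1 f2 = (\<Prod>V\<in>\<V>. g V) * prod_mset M"
  proof -
    have "h \<in># H1" if "min (count H1 h) (count H2 h) \<noteq> 0" for h using that by (metis min_0L not_in_iff)
    hence "{h. E_irreducible h \<and> normalized h \<and> min (count H1 h) (count H2 h) \<noteq> 0} =
          {h. h \<in># H1 \<and> min (count H1 h) (count H2 h) \<noteq> 0}"
      using H by blast
    hence irr: "(\<Prod>h | E_irreducible h \<and> normalized h \<and> min (irreducible_mult h f1) (irreducible_mult h f2) \<noteq> 0.
        h ^ min (irreducible_mult h f1) (irreducible_mult h f2)) = prod_mset M"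
      unfolding M_def irreducible_mult_eq_count[OF e1 t1] irreducible_mult_eq_count[OF e2 t2]
      by (simp only: prod_mset_inter)
    \<comment> \<open>The product in \<open>E_gcd\<close> omits factors equal to 1; off
      \<open>\<V>\<close> a simple part is 1, and so is the gcd.\<close>
    have "V \<in> \<V>" if "g V \<noteq> 1" for V
    proof (rule ccontr)
      assume "V \<notin> \<V>"
      hence "p1 V = 1" unfolding p1_def \<V>_def using simple_part_eq_one[OF e1 t1] by simp
      thus False using that simple_gcd_one by (simp add: g_def)
    qed
    moreover have "rational_line V" if "V \<in> \<V>" for V
      using that rational_line_support by (auto simp: \<V>_def supports_def)
    ultimately have "(\<Prod>V | rational_line V \<and> g V \<noteq> 1. g V) = (\<Prod>V\<in>\<V>. g V)"
      using fin by (intro prod.mono_neutral_left) auto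
    thus ?thesis unfolding E_gcd_def irr by (simp add: g_def p1_def p2_def)
  qed
  define r1 where "r1 = u1 * (\<Prod>V\<in>\<V>. q1 V) * prod_mset (H1 - M)"
  define r2 where "r2 = u2 * (\<Prod>V\<in>\<V>. q2 V) * prod_mset (H2 - M)"
  have H_entire: "entire_fps h" if "h \<in># H1 \<or> h \<in># H2" for h
    using H[OF that] by (simp add: E_irreducible_def E_function_imp_entire)
  have HM_entire: "entire_fps h" if "h \<in># M \<or> h \<in># H1 - M \<or> h \<in># H2 - M" for h
    using that by (intro H_entire) (auto simp: M_def dest: in_diffD)
  \<comment> \<open>A zero of a cofactor is also recorded as a zero of the simple part, since
    \<open>gelfond_schneider\<close> and \<open>conjecture_Z\<close> are applied to zeros of simple
    functions.\<close>
  have r1_zero: "(\<exists>V. q1 V \<noteq> 1 \<and> eval_fps (p1 V) z = 0 \<and> eval_fps (q1 V) z = 0) \<or> (\<exists>h. h \<in># H1 - M \<and> eval_fps h z = 0)"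
    if "eval_fps r1 z = 0" for z
  proof -
    have "eval_fps r1 z = eval_fps u1 z * (\<Prod>V\<in>\<V>. eval_fps (q1 V) z) * (\<Prod>h\<in>#H1 - M. eval_fps h z)"
      unfolding r1_def using HM_entire
      by (simp add: eval_entire_mult eval_entire_prod eval_entire_prod_mset entire_fps_mult entire_fps_prod
          entire_fps_prod_mset E_unit_entire u ent)
    hence "(\<exists>V\<in>\<V>. eval_fps (q1 V) z = 0) \<or> (\<exists>h. h \<in># H1 - M \<and> eval_fps h z = 0)"
      using that fin E_unit_eval_nonzero[OF u(1)] by (auto simp: prod_zero_iff prod_mset_zero_iff)
    moreover have "eval_fps (p1 V) z = 0 \<and> q1 V \<noteq> 1" if "eval_fps (q1 V) z = 0" for V
      using that pq(1)[of V] ent[of V] by (auto simp: eval_entire_mult)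
    ultimately show ?thesis by blast
  qed
  have r2_zero: "(\<exists>V. q2 V \<noteq> 1 \<and> eval_fps (p2 V) z = 0 \<and> eval_fps (q2 V) z = 0) \<or> (\<exists>h. h \<in># H2 - M \<and> eval_fps h z = 0)"
    if "eval_fps r2 z = 0" for z
  proof -
    have "eval_fps r2 z = eval_fps u2 z * (\<Prod>V\<in>\<V>. eval_fps (q2 V) z) * (\<Prod>h\<in>#H2 - M. eval_fps h z)"
      unfolding r2_def using HM_entire
      by (simp add: eval_entire_mult eval_entire_prod eval_entire_prod_mset entire_fps_mult entire_fps_prod
          entire_fps_prod_mset E_unit_entire u ent)
    hence "(\<exists>V\<in>\<V>. eval_fps (q2 V) z = 0) \<or> (\<exists>h. h \<in># H2 - M \<and> eval_fps h z = 0)"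
      using that fin E_unit_eval_nonzero[OF u(2)] by (auto simp: prod_zero_iff prod_mset_zero_iff)
    moreover have "eval_fps (p2 V) z = 0 \<and> q2 V \<noteq> 1" if "eval_fps (q2 V) z = 0" for V
      using that pq(2)[of V] ent[of V] by (auto simp: eval_entire_mult)
    ultimately show ?thesis by blast
  qed
  \<comment> \<open>The zero rules out the default value \<open>p = 1\<close>.\<close>
  have simple_irr: False
    if p: "p = 1 \<or> simple_with_support V p" "eval_fps p z = 0" and h: "h \<in># H1 \<or> h \<in># H2" "eval_fps h z = 0" for p V h z
  proof -
    have "simple_with_support V p" using p by auto
    then obtain \<beta> where "z \<noteq> 0" "algebraic \<beta>" "\<beta> \<noteq> 0" "algebraic (exp (\<beta> * z))"
      using simple_zero p(2) by metis
    thus False using Z H[OF h(1)] h(2) unfolding conjecture_Z_def by blast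
  qed
  have "\<not> (eval_fps r1 z = 0 \<and> eval_fps r2 z = 0)" for z
  proof
    assume r: "eval_fps r1 z = 0 \<and> eval_fps r2 z = 0"
    from r1_zero[of z] r have "(\<exists>V. eval_fps (p1 V) z = 0 \<and> eval_fps (q1 V) z = 0) \<or> (\<exists>h. h \<in># H1 - M \<and> eval_fps h z = 0)"
      by blast
    thus False
    proof (elim disjE exE conjE)
      fix V assume V: "eval_fps (p1 V) z = 0" "eval_fps (q1 V) z = 0"
      from r2_zero[of z] r have "(\<exists>W. eval_fps (p2 W) z = 0 \<and> eval_fps (q2 W) z = 0) \<or> (\<exists>h. h \<in># H2 - M \<and> eval_fps h z = 0)"
        by blast
      thus False
      proof (elim disjE exE conjE)
        fix W assume W: "eval_fps (p2 W) z = 0" "eval_fps (q2 W) z = 0"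
        have "simple_with_support V (p1 V)" "simple_with_support W (p2 W)"
          using p1[of V] p2[of W] V(1) W(1) by auto
        \<comment> \<open>Two simple factors with a common zero share their support, and for a
          single support the cofactors have no common zero.\<close>
        hence "V = W" using V(1) W(1) simple_common_zero_imp_same_support by blast
        thus False using q[of V] V(2) W(2) by (auto simp: coprime_quotients_def)
      next
        fix h assume "h \<in># H2 - M" "eval_fps h z = 0"
        thus False using simple_irr[OF p1 V(1)] by (meson in_diffD)
      qed
    next
      fix h assume h: "h \<in># H1 - M" "eval_fps h z = 0"
      from r2_zero[of z] r have "(\<exists>W. eval_fps (p2 W) z = 0) \<or> (\<exists>k. k \<in># H2 - M \<and> eval_fps k z = 0)"
        by blast
      thus False
      proof (elim disjE exE conjE)
        fix W assume "eval_fps (p2 W) z = 0"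
        thus False using simple_irr[OF p2] h by (meson in_diffD)
      next
        fix k assume k: "k \<in># H2 - M" "eval_fps k z = 0"
        have "h = k"
          using H[of h] H[of k] in_diffD[OF h(1)] in_diffD[OF k(1)] h(2) k(2)
          by (intro irreducible_common_zero_imp_eq[OF F I]) auto
        \<comment> \<open>A factor left over on both sides would have a multiplicity in
          \<open>M\<close> below both of its multiplicities, yet it is their minimum.\<close>
        hence "count H1 h > count M h" "count H2 h > count M h"
          using h(1) k(1) by (simp_all add: in_diff_count)
        thus False by (simp add: M_def)
      qed
    qed
  qed
  moreover have "f1 = E_gcd f1 f2 * r1"
  proof -
    have "f1 = u1 * ((\<Prod>V\<in>\<V>. g V) * (\<Prod>V\<in>\<V>. q1 V)) * (prod_mset M * prod_mset (H1 - M))"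
      unfolding prod.distrib[symmetric] prod_mset_Un[symmetric] HM(1)[symmetric] pq(1)[symmetric] prod1 by (rule f1_eq)
    also have "\<dots> = E_gcd f1 f2 * r1" unfolding gcd_eq r1_def by (simp add: mult_ac)
    finally show ?thesis .
  qed
  moreover have "f2 = E_gcd f1 f2 * r2"
  proof -
    have "f2 = u2 * ((\<Prod>V\<in>\<V>. g V) * (\<Prod>V\<in>\<V>. q2 V)) * (prod_mset M * prod_mset (H2 - M))"
      unfolding prod.distrib[symmetric] prod_mset_Un[symmetric] HM(2)[symmetric] pq(2)[symmetric] prod2 by (rule f2_eq)
    also have "\<dots> = E_gcd f1 f2 * r2" unfolding gcd_eq r2_def by (simp add: mult_ac)
    finally show ?thesis .
  qed
  moreover have "entire_fps (E_gcd f1 f2)" unfolding gcd_eq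
    using HM_entire by (intro entire_fps_mult entire_fps_prod entire_fps_prod_mset ent) auto
  moreover have "entire_fps r1" unfolding r1_def
    using HM_entire by (intro entire_fps_mult entire_fps_prod entire_fps_prod_mset ent E_unit_entire[OF u(1)]) auto
  moreover have "entire_fps r2" unfolding r2_def
    using HM_entire by (intro entire_fps_mult entire_fps_prod entire_fps_prod_mset ent E_unit_entire[OF u(2)]) auto
  ultimately have "coprime_quotients f1 f2 (E_gcd f1 f2) r1 r2"
    unfolding coprime_quotients_def by (intro conjI allI)
  thus ?thesis by blast
qed

theorem theorem8:
  shows "(conjecture_F \<and> conjecture_I \<and> conjecture_Z \<longrightarrow>
            (\<forall>f1 f2. E_function f1 \<and> f1 \<noteq> 0 \<and> E_function f2 \<and> f2 \<noteq> 0 \<longrightarrow>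
               quotients_without_common_zero f1 f2 (E_gcd f1 f2) \<and>
               common_zeros_with_min_order f1 f2 (E_gcd f1 f2)))
         \<and> (\<forall>g1 g2. E_simple g1 \<and> E_simple g2 \<longrightarrow>
               quotients_without_common_zero g1 g2 (simple_gcd g1 g2) \<and>
               common_zeros_with_min_order g1 g2 (simple_gcd g1 g2))"
proof (intro conjI impI allI)
  fix f1 f2
  assume C: "conjecture_F \<and> conjecture_I \<and> conjecture_Z"
    and f: "E_function f1 \<and> f1 \<noteq> 0 \<and> E_function f2 \<and> f2 \<noteq> 0"
  obtain q1 q2 where q: "coprime_quotients f1 f2 (E_gcd f1 f2) q1 q2"
    using E_gcd_coprime_quotients[of f1 f2] C f by blast
  show "quotients_without_common_zero f1 f2 (E_gcd f1 f2)"
    using coprime_quotients_imp_quotients_without_common_zero[OF q] f by blast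
  show "common_zeros_with_min_order f1 f2 (E_gcd f1 f2)"
    using coprime_quotients_imp_common_zeros[OF q] f by blast
next
  fix g1 g2
  assume g: "E_simple g1 \<and> E_simple g2"
  then obtain q1 q2 where q: "coprime_quotients g1 g2 (simple_gcd g1 g2) q1 q2"
    using simple_gcd_coprime_quotients[of g1 g2] by blast
  have nz: "g1 \<noteq> 0" "g2 \<noteq> 0" using g simple_nonzero unfolding E_simple_def by blast+
  show "quotients_without_common_zero g1 g2 (simple_gcd g1 g2)"
    by (rule coprime_quotients_imp_quotients_without_common_zero[OF q nz(1)])
  show "common_zeros_with_min_order g1 g2 (simple_gcd g1 g2)"
    by (rule coprime_quotients_imp_common_zeros[OF q nz])
qed

end
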